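(* Let $M$ be a compact connected oriented Riemannian manifold without boundary with Riemannian volume form $\mathrm{vol}_M$. Let $u=(u_1,\dots,u_n)$, $\mu=(\mu_1,\dots,\mu_n)$ be a (smooth, time-dependent) solution of the multiphase fluid equations $$\partial_tu_j+\nabla_{u_j}u_j=-\nabla p,\qquad\partial_t\mu_j=-\mathcal{L}_{u_j}\mu_j,\qquad j=1,\dots,n,$$ where $p\in C^\infty(M)$ (at each time) is common for all phases, $\mu\in\mathrm{MDens}(M)$ and $\sum_{j=1}^n\mathcal{L}_{u_j}\mu_j=0$. Then the multiphase vorticity $\omega=(\omega_1,\dots,\omega_n)$, $\omega_j:=du_j^\flat$, is frozen into the flow in the generalized sense: $\partial_t\omega+\mathcal{L}_u\omega=0$ component-wise, that is, the vorticity of each phase is transported by the corresponding velocity field: $$\partial_t\omega_j+\mathcal{L}_{u_j}\omega_j=0,\qquad j=1,\dots,n.$$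
   Context: $u_j^\flat$ is the 1-form dual to the vector field $u_j$ with respect to the Riemannian metric; $\mathcal{L}$ is the Lie derivative. For fixed constants $c_1,\dots,c_n$ with $\sum_jc_j=\int_M\mathrm{vol}_M$, $\mathrm{MDens}(M)$ is the set of $n$-tuples $\mu=(\mu_1,\dots,\mu_n)$ of everywhere positive smooth densities (top-degree forms) on $M$ with $\sum_j\mu_j=\mathrm{vol}_M$ and $\int_M\mu_j=c_j$. *)

theory Defs
  imports "HOL-Analysis.Analysis"
begin

section \<open>Smooth maps between normed spaces\<close>

text \<open>\<open>S\<close> is always an open subset of a finite-dimensional space below, where continuity of all
  iterated directional derivatives of total derivatives is the usual notion of class C^k.\<close>

primrec Ck_on :: "nat \<Rightarrow> 'e::real_normed_vector set \<Rightarrow> ('e \<Rightarrow> 'f::real_normed_vector) \<Rightarrow> bool" where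
  "Ck_on 0 S f \<longleftrightarrow> continuous_on S f"
| "Ck_on (Suc k) S f \<longleftrightarrow>
     (\<forall>x\<in>S. f differentiable (at x)) \<and> (\<forall>v. Ck_on k S (\<lambda>x. frechet_derivative f (at x) v))"

definition smooth_on :: "'e::real_normed_vector set \<Rightarrow> ('e \<Rightarrow> 'f::real_normed_vector) \<Rightarrow> bool" where
  "smooth_on S f \<longleftrightarrow> (\<forall>k. Ck_on k S f)"

section \<open>Oriented smooth manifolds\<close>

text \<open>The manifold is the whole type \<open>'a\<close>, of dimension \<open>CARD('m)\<close>. A chart is its domain together
  with its coordinate map. An oriented atlas carries both the smooth structure and the orientation.\<close>

type_synonym ('a, 'm) chart = "'a set \<times> ('a \<Rightarrow> real ^ 'm)"

definition chart_inv :: "('a, 'm::finite) chart \<Rightarrow> real ^ 'm \<Rightarrow> 'a" where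
  "chart_inv c = inv_into (fst c) (snd c)"

definition is_chart :: "('a::topological_space, 'm::finite) chart \<Rightarrow> bool" where
  "is_chart c \<longleftrightarrow> open (fst c) \<and> open (snd c ` fst c) \<and>
     homeomorphism (fst c) (snd c ` fst c) (snd c) (chart_inv c)"

definition oriented_atlas :: "('a::topological_space, 'm::finite) chart set \<Rightarrow> bool" where
  "oriented_atlas A \<longleftrightarrow>
     (\<forall>c\<in>A. is_chart c) \<and> (\<Union>c\<in>A. fst c) = UNIV \<and>
     (\<forall>c\<in>A. \<forall>d\<in>A. smooth_on (snd c ` (fst c \<inter> fst d)) (snd d \<circ> chart_inv c) \<and>
        (\<forall>y \<in> snd c ` (fst c \<inter> fst d).
           det (matrix (frechet_derivative (snd d \<circ> chart_inv c) (at y))) > 0))"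

definition smooth_fun ::
    "('a::topological_space, 'm::finite) chart set \<Rightarrow> 'a set \<Rightarrow> ('a \<Rightarrow> real) \<Rightarrow> bool" where
  "smooth_fun A U f \<longleftrightarrow> (\<forall>c\<in>A. smooth_on (snd c ` (U \<inter> fst c)) (f \<circ> chart_inv c))"

text \<open>Joint smoothness on \<open>I \<times> U\<close>, with \<open>I\<close> an open set of times and \<open>U\<close> open in the manifold.\<close>

definition smooth_time_fun ::
    "('a::topological_space, 'm::finite) chart set \<Rightarrow> real set \<Rightarrow> 'a set \<Rightarrow> (real \<Rightarrow> 'a \<Rightarrow> real) \<Rightarrow> bool" where
  "smooth_time_fun A I U h \<longleftrightarrow>
     (\<forall>c\<in>A. smooth_on (I \<times> snd c ` (U \<inter> fst c)) (\<lambda>(t, y). h t (chart_inv c y)))"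

definition smooth_near ::
    "('a::topological_space, 'm::finite) chart set \<Rightarrow> 'a \<Rightarrow> ('a \<Rightarrow> real) \<Rightarrow> bool" where
  "smooth_near A q f \<longleftrightarrow> (\<exists>U. open U \<and> q \<in> U \<and> smooth_fun A U f)"

section \<open>Tangent vectors and vector fields\<close>

text \<open>Tangent vectors at \<open>q\<close> are the derivations of germs at \<open>q\<close> of smooth functions. A germ is
  represented by any total function that is smooth near \<open>q\<close>; the value at all other functions is
  fixed to be 0, so that equality of tangent vectors is equality in HOL.\<close>

type_synonym 'a tangent = "('a \<Rightarrow> real) \<Rightarrow> real"
type_synonym 'a vfield = "'a \<Rightarrow> 'a tangent"

definition tangent_space ::
    "('a::topological_space, 'm::finite) chart set \<Rightarrow> 'a \<Rightarrow> 'a tangent set" where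
  "tangent_space A q = {v.
     (\<forall>f. \<not> smooth_near A q f \<longrightarrow> v f = 0) \<and>
     (\<forall>f g. smooth_near A q f \<longrightarrow> smooth_near A q g \<longrightarrow>
        ((\<forall>\<^sub>F x in nhds q. f x = g x) \<longrightarrow> v f = v g) \<and>
        (\<forall>a b. v (\<lambda>x. a * f x + b * g x) = a * v f + b * v g) \<and>
        v (\<lambda>x. f x * g x) = f q * v g + g q * v f)}"

definition coord_vec ::
    "('a::topological_space, 'm::finite) chart set \<Rightarrow> ('a, 'm) chart \<Rightarrow> 'a \<Rightarrow> 'm \<Rightarrow> 'a tangent" where
  "coord_vec A c q i = (\<lambda>f. if smooth_near A q f
     then frechet_derivative (f \<circ> chart_inv c) (at (snd c q)) (axis i 1) else 0)"

definition vector_field_on ::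
    "('a::topological_space, 'm::finite) chart set \<Rightarrow> 'a set \<Rightarrow> 'a vfield \<Rightarrow> bool" where
  "vector_field_on A U X \<longleftrightarrow> (\<forall>q\<in>U. X q \<in> tangent_space A q) \<and>
     (\<forall>V f. open V \<longrightarrow> V \<subseteq> U \<longrightarrow> smooth_fun A V f \<longrightarrow> smooth_fun A V (\<lambda>q. X q f))"

abbreviation vector_field ::
    "('a::topological_space, 'm::finite) chart set \<Rightarrow> 'a vfield \<Rightarrow> bool" where
  "vector_field A \<equiv> vector_field_on A UNIV"

definition time_vector_field ::
    "('a::topological_space, 'm::finite) chart set \<Rightarrow> real set \<Rightarrow> (real \<Rightarrow> 'a vfield) \<Rightarrow> bool" where
  "time_vector_field A I u \<longleftrightarrow> (\<forall>t\<in>I. vector_field A (u t)) \<and>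
     (\<forall>V f. open V \<longrightarrow> smooth_fun A V f \<longrightarrow> smooth_time_fun A I V (\<lambda>t q. u t q f))"

definition lie_bracket ::
    "('a::topological_space, 'm::finite) chart set \<Rightarrow> 'a vfield \<Rightarrow> 'a vfield \<Rightarrow> 'a vfield" where
  "lie_bracket A X Y q = (\<lambda>f. if smooth_near A q f
     then X q (\<lambda>x. Y x f) - Y q (\<lambda>x. X x f) else 0)"

section \<open>Riemannian geometry\<close>

definition riemannian_metric ::
    "('a::topological_space, 'm::finite) chart set \<Rightarrow> ('a \<Rightarrow> 'a tangent \<Rightarrow> 'a tangent \<Rightarrow> real) \<Rightarrow> bool" where
  "riemannian_metric A g \<longleftrightarrow>
     (\<forall>q. \<forall>v\<in>tangent_space A q. \<forall>w\<in>tangent_space A q. g q v w = g q w v) \<and>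
     (\<forall>q. \<forall>v\<in>tangent_space A q. \<forall>w\<in>tangent_space A q. \<forall>z\<in>tangent_space A q. \<forall>a b.
        g q (\<lambda>f. a * v f + b * w f) z = a * g q v z + b * g q w z) \<and>
     (\<forall>q. \<forall>v\<in>tangent_space A q. v \<noteq> (\<lambda>f. 0) \<longrightarrow> g q v v > 0) \<and>
     (\<forall>U X Y. open U \<longrightarrow> vector_field_on A U X \<longrightarrow> vector_field_on A U Y \<longrightarrow>
        smooth_fun A U (\<lambda>q. g q (X q) (Y q)))"

text \<open>The Levi-Civita connection is determined by being a torsion-free metric connection; only
  its values at smooth vector fields matter.\<close>

definition levi_civita ::
    "('a::topological_space, 'm::finite) chart set \<Rightarrow> ('a \<Rightarrow> 'a tangent \<Rightarrow> 'a tangent \<Rightarrow> real) \<Rightarrow>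
      ('a vfield \<Rightarrow> 'a vfield \<Rightarrow> 'a vfield) \<Rightarrow> bool" where
  "levi_civita A g D \<longleftrightarrow>
     (\<forall>X Y. vector_field A X \<longrightarrow> vector_field A Y \<longrightarrow>
        vector_field A (D X Y) \<and>
        (\<forall>q h. D X Y q h - D Y X q h = lie_bracket A X Y q h)) \<and>
     (\<forall>X Y Z. vector_field A X \<longrightarrow> vector_field A Y \<longrightarrow> vector_field A Z \<longrightarrow>
        D (\<lambda>q h. X q h + Y q h) Z = (\<lambda>q h. D X Z q h + D Y Z q h) \<and>
        D X (\<lambda>q h. Y q h + Z q h) = (\<lambda>q h. D X Y q h + D X Z q h) \<and>
        (\<forall>q. X q (\<lambda>x. g x (Y x) (Z x)) = g q (D X Y q) (Z q) + g q (Y q) (D X Z q))) \<and>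
     (\<forall>X Y f. vector_field A X \<longrightarrow> vector_field A Y \<longrightarrow> smooth_fun A UNIV f \<longrightarrow>
        D (\<lambda>q h. f q * X q h) Y = (\<lambda>q h. f q * D X Y q h) \<and>
        D X (\<lambda>q h. f q * Y q h) = (\<lambda>q h. X q f * Y q h + f q * D X Y q h))"

definition grad ::
    "('a::topological_space, 'm::finite) chart set \<Rightarrow> ('a \<Rightarrow> 'a tangent \<Rightarrow> 'a tangent \<Rightarrow> real) \<Rightarrow>
      ('a \<Rightarrow> real) \<Rightarrow> 'a vfield" where
  "grad A g f q = (THE w. w \<in> tangent_space A q \<and> (\<forall>v\<in>tangent_space A q. g q w v = v f))"

section \<open>Differential forms\<close>

text \<open>Forms are regarded as maps on (tuples of) smooth vector fields that are multilinear over
  the smooth functions; two forms are compared on smooth vector fields only. A top-degree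
  form takes a tuple of vector fields indexed by \<open>'m\<close>.\<close>

type_synonym 'a form1 = "'a vfield \<Rightarrow> 'a \<Rightarrow> real"
type_synonym 'a form2 = "'a vfield \<Rightarrow> 'a vfield \<Rightarrow> 'a \<Rightarrow> real"
type_synonym ('a, 'm) topform = "('m \<Rightarrow> 'a vfield) \<Rightarrow> 'a \<Rightarrow> real"

definition flat :: "('a \<Rightarrow> 'a tangent \<Rightarrow> 'a tangent \<Rightarrow> real) \<Rightarrow> 'a vfield \<Rightarrow> 'a form1" where
  "flat g X = (\<lambda>Y q. g q (X q) (Y q))"

definition ext_deriv ::
    "('a::topological_space, 'm::finite) chart set \<Rightarrow> 'a form1 \<Rightarrow> 'a form2" where
  "ext_deriv A \<alpha> = (\<lambda>X Y q. X q (\<alpha> Y) - Y q (\<alpha> X) - \<alpha> (lie_bracket A X Y) q)"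

text \<open>The Lie derivative of covariant tensors: the derivation that is differentiation on functions
  and the Lie bracket on vector fields.\<close>

definition lie_form2 ::
    "('a::topological_space, 'm::finite) chart set \<Rightarrow> 'a vfield \<Rightarrow> 'a form2 \<Rightarrow> 'a form2" where
  "lie_form2 A u \<omega> = (\<lambda>X Y q.
     u q (\<omega> X Y) - \<omega> (lie_bracket A u X) Y q - \<omega> X (lie_bracket A u Y) q)"

definition lie_topform ::
    "('a::topological_space, 'm::finite) chart set \<Rightarrow> 'a vfield \<Rightarrow> ('a, 'm) topform \<Rightarrow> ('a, 'm) topform" where
  "lie_topform A u \<mu> = (\<lambda>X q.
     u q (\<mu> X) - (\<Sum>i\<in>UNIV. \<mu> (X(i := lie_bracket A u (X i))) q))"

definition is_topform ::
    "('a::topological_space, 'm::finite) chart set \<Rightarrow> ('a, 'm) topform \<Rightarrow> bool" where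
  "is_topform A \<mu> \<longleftrightarrow> (\<forall>X. (\<forall>i. vector_field A (X i)) \<longrightarrow>
     smooth_fun A UNIV (\<mu> X) \<and>
     (\<forall>i Y Z f h. vector_field A Y \<longrightarrow> vector_field A Z \<longrightarrow>
        smooth_fun A UNIV f \<longrightarrow> smooth_fun A UNIV h \<longrightarrow>
        \<mu> (X(i := (\<lambda>q s. f q * Y q s + h q * Z q s))) =
          (\<lambda>q. f q * \<mu> (X(i := Y)) q + h q * \<mu> (X(i := Z)) q)) \<and>
     (\<forall>i j. i \<noteq> j \<longrightarrow> X i = X j \<longrightarrow> \<mu> X = (\<lambda>q. 0)))"

definition time_topform ::
    "('a::topological_space, 'm::finite) chart set \<Rightarrow> real set \<Rightarrow> (real \<Rightarrow> ('a, 'm) topform) \<Rightarrow> bool" where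
  "time_topform A I \<mu> \<longleftrightarrow> (\<forall>t\<in>I. is_topform A (\<mu> t)) \<and>
     (\<forall>X. (\<forall>i. vector_field A (X i)) \<longrightarrow> smooth_time_fun A I UNIV (\<lambda>t. \<mu> t X))"

text \<open>\<open>v j (\<lambda>x. snd c x $ i)\<close> is the \<open>i\<close>-th component of \<open>v j\<close> in the chart \<open>c\<close>. By orientedness
  of the atlas the sign of the determinant does not depend on the chart.\<close>

definition positive_frame ::
    "('a::topological_space, 'm::finite) chart set \<Rightarrow> 'a \<Rightarrow> ('m \<Rightarrow> 'a tangent) \<Rightarrow> bool" where
  "positive_frame A q v \<longleftrightarrow>
     (\<exists>c\<in>A. q \<in> fst c \<and> det (\<chi> i j. v j (\<lambda>x. snd c x $ i)) > 0)"

definition vol_form ::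
    "('a::topological_space, 'm::finite) chart set \<Rightarrow> ('a \<Rightarrow> 'a tangent \<Rightarrow> 'a tangent \<Rightarrow> real) \<Rightarrow>
      ('a, 'm) topform" where
  "vol_form A g = (\<lambda>X q. (if positive_frame A q (\<lambda>i. X i q) then 1 else - 1) *
     sqrt (det (\<chi> i j. g q (X i q) (X j q))))"

definition positive_topform ::
    "('a::topological_space, 'm::finite) chart set \<Rightarrow> ('a, 'm) topform \<Rightarrow> bool" where
  "positive_topform A \<mu> \<longleftrightarrow> (\<forall>X q. (\<forall>i. vector_field A (X i)) \<longrightarrow>
     positive_frame A q (\<lambda>i. X i q) \<longrightarrow> \<mu> X q > 0)"

section \<open>Integration of top-degree forms\<close>

text \<open>Value of a top-degree form on tangent vectors at a point, through any extension of these to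
  smooth vector fields (by tensoriality the choice does not matter).\<close>

definition topform_at ::
    "('a::topological_space, 'm::finite) chart set \<Rightarrow> ('a, 'm) topform \<Rightarrow> 'a \<Rightarrow> ('m \<Rightarrow> 'a tangent) \<Rightarrow> real" where
  "topform_at A \<mu> q v = \<mu> (SOME X. \<forall>i. vector_field A (X i) \<and> X i q = v i) q"

definition partition_of_unity ::
    "('a::topological_space, 'm::finite) chart set \<Rightarrow> (('a, 'm) chart \<times> ('a \<Rightarrow> real)) set \<Rightarrow> bool" where
  "partition_of_unity A F \<longleftrightarrow> finite F \<and>
     (\<forall>(c, \<rho>)\<in>F. c \<in> A \<and> smooth_fun A UNIV \<rho> \<and> (\<forall>x. \<rho> x \<ge> 0) \<and>
        closure {x. \<rho> x \<noteq> 0} \<subseteq> fst c) \<and>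
     (\<forall>x. (\<Sum>(c, \<rho>)\<in>F. \<rho> x) = 1)"

text \<open>The integral over a compact manifold; the value does not depend on the chosen partition of
  unity.\<close>

definition topform_integral ::
    "('a::topological_space, 'm::finite) chart set \<Rightarrow> ('a, 'm) topform \<Rightarrow> real" where
  "topform_integral A \<mu> =
     (\<Sum>(c, \<rho>)\<in>(SOME F. partition_of_unity A F).
        (LINT y:(snd c ` fst c)|lborel.
           \<rho> (chart_inv c y) * topform_at A \<mu> (chart_inv c y) (coord_vec A c (chart_inv c y))))"

section \<open>Multiphase densities and vorticity\<close>

definition MDens ::
    "('a::topological_space, 'm::finite) chart set \<Rightarrow> ('a \<Rightarrow> 'a tangent \<Rightarrow> 'a tangent \<Rightarrow> real) \<Rightarrow>
      nat \<Rightarrow> (nat \<Rightarrow> real) \<Rightarrow> (nat \<Rightarrow> ('a, 'm) topform) set" where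
  "MDens A g n c = {\<mu>.
     (\<forall>j\<in>{1..n}. is_topform A (\<mu> j) \<and> positive_topform A (\<mu> j) \<and> topform_integral A (\<mu> j) = c j) \<and>
     (\<forall>X q. (\<forall>i. vector_field A (X i)) \<longrightarrow> (\<Sum>j=1..n. \<mu> j X q) = vol_form A g X q)}"

definition vorticity ::
    "('a::topological_space, 'm::finite) chart set \<Rightarrow> ('a \<Rightarrow> 'a tangent \<Rightarrow> 'a tangent \<Rightarrow> real) \<Rightarrow>
      'a vfield \<Rightarrow> 'a form2" where
  "vorticity A g u = ext_deriv A (flat g u)"

end

theory Submission
  imports Defs
begin

text \<open>Put \<open>\<alpha> = u\<^sub>j\<^sup>\<flat>\<close>. Since the Levi-Civita connection is metric and torsion free,
  \<open>(\<nabla>\<^sub>u u)\<^sup>\<flat> = L\<^sub>u \<alpha> - d(|u|\<^sup>2 / 2)\<close>, so the Euler equation becomes \<open>\<partial>\<^sub>t \<alpha> + L\<^sub>u \<alpha> = d(|u|\<^sup>2 / 2 - p)\<close>.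
  Applying the exterior derivative, which commutes with \<open>\<partial>\<^sub>t\<close> (symmetry of mixed partial derivatives)
  and with \<open>L\<^sub>u\<close> (Jacobi identity), removes the right-hand side. As tangent vectors are derivations,
  Hadamard's lemma is needed to expand them in coordinates; this reduces the regularity of
  \<open>g(u, Y)\<close> in time to that of the coordinate components of \<open>u\<close>.\<close>

section \<open>Calculus of smooth maps\<close>

text \<open>Commuting the time derivative with \<open>d\<close> means moving it past
  \<open>X q\<close>, an abstract derivation applied to the whole function
  \<open>flat g (u s) Y\<close>. A derivation comes with no continuity, so nothing lets it pass
  through a limit in \<open>s\<close> until it is a fixed finite combination of partial derivatives;
  only then is symmetry of mixed partials applicable. The metric poses a similar obstacle: it
  accepts a whole tangent vector and is smooth only along smooth fields, while the time regularity
  of \<open>u\<close> is given for the numbers \<open>u t q f\<close>. Coordinate vectors, which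
  mediate in both cases, exist only over a chart domain, so local fields appear beside global ones.
  The Lie calculus, by contrast, is done without coordinates by iterating derivations; there the
  care goes into germs, since an inner function may be replaced only by one that agrees with it on a
  whole neighbourhood.\<close>

lemma frechet_derivative_cong:
  assumes "open S" "x \<in> S" "\<And>y. y \<in> S \<Longrightarrow> f y = g y"
  shows "frechet_derivative f (at x) = frechet_derivative g (at x)"
proof -
  have "(f has_derivative D) (at x) \<longleftrightarrow> (g has_derivative D) (at x)" for D
    using assms by (metis has_derivative_transform_within_open)
  then show ?thesis by (simp add: frechet_derivative_def)
qed

text \<open>Derivatives are taken in the whole space, so agreement on \<open>S\<close> determines
  them because \<open>S\<close> is open. The equivalence also covers maps without a derivative,
  where \<open>frechet_derivative\<close> is an arbitrary choice.\<close>

lemma Ck_on_cong: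
  assumes "open S" "\<And>y. y \<in> S \<Longrightarrow> f y = g y"
  shows "Ck_on k S f \<longleftrightarrow> Ck_on k S g"
  using assms(2)
proof (induction k arbitrary: f g)
  case 0
  then show ?case by (auto intro: continuous_on_cong)
next
  case (Suc k)
  have "f differentiable (at x) \<longleftrightarrow> g differentiable (at x)" if "x \<in> S" for x
    using that Suc.prems assms(1) unfolding differentiable_def
    by (metis has_derivative_transform_within_open)
  moreover have "Ck_on k S (\<lambda>x. frechet_derivative f (at x) v)
      \<longleftrightarrow> Ck_on k S (\<lambda>x. frechet_derivative g (at x) v)" for v
    by (rule Suc.IH) (metis frechet_derivative_cong assms(1) Suc.prems)
  ultimately show ?case by simp
qed

lemma Ck_on_subset: "Ck_on k S f \<Longrightarrow> T \<subseteq> S \<Longrightarrow> Ck_on k T f"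
  by (induction k arbitrary: f) (auto intro: continuous_on_subset)

lemma Ck_on_SucD: "Ck_on (Suc k) S f \<Longrightarrow> Ck_on k S f"
proof (induction k arbitrary: f)
  case 0
  then have "isCont f x" if "x \<in> S" for x
    using that differentiable_imp_continuous_within by auto
  then show ?case by (simp add: continuous_at_imp_continuous_on)
next
  case (Suc k)
  from Suc.prems have d: "\<forall>x\<in>S. f differentiable (at x)"
      and "Ck_on (Suc k) S (\<lambda>x. frechet_derivative f (at x) v)" for v
    unfolding Ck_on.simps(2)[of "Suc k"] by blast+
  then have "Ck_on k S (\<lambda>x. frechet_derivative f (at x) v)" for v
    by (intro Suc.IH)
  with d show ?case unfolding Ck_on.simps(2)[of k] by simp
qed

text \<open>Trades the chosen \<open>frechet_derivative\<close> for an explicit one. The direction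
  comes first in \<open>f' v x\<close> so that \<open>f' v\<close> is again a map on
  \<open>S\<close>, ready for an induction hypothesis.\<close>

lemma Ck_on_SucI:
  assumes "open S" "\<And>x. x \<in> S \<Longrightarrow> (f has_derivative (\<lambda>v. f' v x)) (at x)"
    and "\<And>v. Ck_on k S (f' v)"
  shows "Ck_on (Suc k) S f"
proof -
  have "frechet_derivative f (at x) = (\<lambda>v. f' v x)" if "x \<in> S" for x
    using frechet_derivative_at[OF assms(2)[OF that]] by simp
  then have "Ck_on k S (\<lambda>x. frechet_derivative f (at x) v) \<longleftrightarrow> Ck_on k S (f' v)" for v
    by (intro Ck_on_cong assms(1)) simp
  moreover have "\<forall>x\<in>S. f differentiable (at x)"
    using assms(2) differentiableI by blast
  ultimately show ?thesis using assms(3) by simp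
qed

lemma Ck_on_SucE:
  assumes "Ck_on (Suc k) S f" "x \<in> S"
  shows "(f has_derivative frechet_derivative f (at x)) (at x)"
  using assms by (auto simp: frechet_derivative_works)

lemma Ck_on_frechet_derivative:
  "Ck_on (Suc k) S f \<Longrightarrow> Ck_on k S (\<lambda>x. frechet_derivative f (at x) v)"
  by simp

declare Ck_on.simps(2) [simp del]

lemma Ck_on_const: "open S \<Longrightarrow> Ck_on k S (\<lambda>x. c)"
proof (induction k arbitrary: c)
  case (Suc k)
  show ?case
    by (rule Ck_on_SucI[where f' = "\<lambda>v x. 0"]) (use Suc in auto)
qed simp

lemma Ck_on_add:
  assumes "open S" "Ck_on k S f" "Ck_on k S g"
  shows "Ck_on k S (\<lambda>x. f x + g x)"
  using assms(2,3)
proof (induction k arbitrary: f g)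
  case 0
  then show ?case by (auto intro: continuous_intros)
next
  case (Suc k)
  show ?case
    by (rule Ck_on_SucI[where f' = "\<lambda>v x. frechet_derivative f (at x) v + frechet_derivative g (at x) v"])
      (intro assms Suc.IH has_derivative_add Ck_on_SucE[OF Suc.prems(1)] Ck_on_SucE[OF Suc.prems(2)]
        Ck_on_frechet_derivative Suc.prems; assumption)+
qed

lemma Ck_on_sum:
  assumes "open S" "\<And>i. i \<in> B \<Longrightarrow> Ck_on k S (f i)"
  shows "Ck_on k S (\<lambda>x. \<Sum>i\<in>B. f i x)"
  using assms(2) by (induction B rule: infinite_finite_induct) (auto intro: Ck_on_const Ck_on_add assms(1))

text \<open>One induction serves products of reals and scalar multiples alike. The product rule
  gives a sum of terms of the same shape, with one factor differentiated and the other weakened by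
  \<open>Ck_on_SucD\<close>.\<close>

lemma Ck_on_bilinear:
  assumes "bounded_bilinear bil" "open S" "Ck_on k S f" "Ck_on k S g"
  shows "Ck_on k S (\<lambda>x. bil (f x) (g x))"
  using assms(3,4)
proof (induction k arbitrary: f g)
  case 0
  then show ?case using bounded_bilinear.continuous_on[OF assms(1)] by auto
next
  case (Suc k)
  show ?case
  proof (rule Ck_on_SucI[where f' = "\<lambda>v x. bil (f x) (frechet_derivative g (at x) v)
      + bil (frechet_derivative f (at x) v) (g x)"])
    show "((\<lambda>x. bil (f x) (g x)) has_derivative
        (\<lambda>v. bil (f x) (frechet_derivative g (at x) v) + bil (frechet_derivative f (at x) v) (g x))) (at x)"
      if "x \<in> S" for x
      using bounded_bilinear.FDERIV[OF assms(1) Ck_on_SucE[OF Suc.prems(1) that]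
          Ck_on_SucE[OF Suc.prems(2) that]] .
    show "Ck_on k S (\<lambda>x. bil (f x) (frechet_derivative g (at x) v)
      + bil (frechet_derivative f (at x) v) (g x))" for v
      by (intro Ck_on_add Suc.IH assms Ck_on_SucD[OF Suc.prems(1)] Ck_on_SucD[OF Suc.prems(2)]
          Ck_on_frechet_derivative Suc.prems)
  qed (rule assms)
qed

lemma Ck_on_linear:
  assumes "bounded_linear L" "open S" "Ck_on k S f"
  shows "Ck_on k S (\<lambda>x. L (f x))"
  using assms(3)
proof (induction k arbitrary: f)
  case 0
  then show ?case using bounded_linear.continuous_on[OF assms(1)] by auto
next
  case (Suc k)
  show ?case
    by (rule Ck_on_SucI[where f' = "\<lambda>v x. L (frechet_derivative f (at x) v)"])
      (intro assms(2) Suc.IH bounded_linear.has_derivative[OF assms(1)] Ck_on_SucE[OF Suc.prems]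
        Ck_on_frechet_derivative Suc.prems; assumption)+
qed

lemma Ck_on_ident: "open S \<Longrightarrow> Ck_on k S (\<lambda>x. x)"
proof (cases k)
  case (Suc k)
  assume "open S"
  then show ?thesis unfolding Suc
    by (intro Ck_on_SucI[where f' = "\<lambda>v x. v"]) (auto intro: Ck_on_const)
qed simp

text \<open>\<open>Ck_on\<close> tests derivatives along fixed directions only. In the chain rule
  the inner direction moves with the point, and this expansion puts the motion into scalar
  coefficients.\<close>

lemma linear_euclidean_sum:
  fixes L :: "'e::euclidean_space \<Rightarrow> 'f::real_normed_vector"
  assumes "linear L"
  shows "L w = (\<Sum>b\<in>Basis. (w \<bullet> b) *\<^sub>R L b)"
proof -
  have "L w = L (\<Sum>b\<in>Basis. (w \<bullet> b) *\<^sub>R b)"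
    by (simp only: euclidean_representation)
  also have "\<dots> = (\<Sum>b\<in>Basis. (w \<bullet> b) *\<^sub>R L b)"
    by (simp only: linear_sum[OF assms] linear_scale[OF assms])
  finally show ?thesis .
qed

text \<open>The induction generalises \<open>f\<close> but keeps \<open>g\<close>: differentiation
  leaves partial derivatives of \<open>f\<close> composed with the same \<open>g\<close>, times
  components of the derivative of \<open>g\<close>.\<close>

lemma Ck_on_compose:
  fixes g :: "'e::real_normed_vector \<Rightarrow> 'f::euclidean_space"
  assumes "open S" "open T" "g ` S \<subseteq> T" "Ck_on k S g" "Ck_on k T f"
  shows "Ck_on k S (\<lambda>x. f (g x))"
  using assms(4,5)
proof (induction k arbitrary: f)
  case 0
  then show ?case using assms(3) by (auto intro: continuous_on_compose2)
next
  case (Suc k)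
  let ?D = "frechet_derivative"
  show ?case
  proof (rule Ck_on_SucI[where f' = "\<lambda>v x. \<Sum>b\<in>Basis. (?D g (at x) v \<bullet> b) *\<^sub>R ?D f (at (g x)) b"])
    fix x assume "x \<in> S"
    then have gx: "g x \<in> T" using assms(3) by blast
    note df = Ck_on_SucE[OF Suc.prems(2) gx]
    have "((\<lambda>x. f (g x)) has_derivative (\<lambda>v. ?D f (at (g x)) (?D g (at x) v))) (at x)"
      by (rule has_derivative_compose[OF Ck_on_SucE[OF Suc.prems(1) \<open>x \<in> S\<close>] df])
    moreover have "(\<lambda>v. ?D f (at (g x)) (?D g (at x) v))
        = (\<lambda>v. \<Sum>b\<in>Basis. (?D g (at x) v \<bullet> b) *\<^sub>R ?D f (at (g x)) b)"
      by (rule ext) (rule linear_euclidean_sum[OF has_derivative_linear[OF df]])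
    ultimately show "((\<lambda>x. f (g x)) has_derivative
        (\<lambda>v. \<Sum>b\<in>Basis. (?D g (at x) v \<bullet> b) *\<^sub>R ?D f (at (g x)) b)) (at x)"
      by simp
  next
    fix v
    show "Ck_on k S (\<lambda>x. \<Sum>b\<in>Basis. (?D g (at x) v \<bullet> b) *\<^sub>R ?D f (at (g x)) b)"
      by (intro Ck_on_sum Ck_on_bilinear[OF bounded_bilinear_scaleR] assms Suc.IH
          Ck_on_linear[OF bounded_linear_inner_left] Ck_on_SucD[OF Suc.prems(1)]
          Ck_on_frechet_derivative Suc.prems)
  qed (rule assms)
qed

lemma smooth_on_subset: "smooth_on S f \<Longrightarrow> T \<subseteq> S \<Longrightarrow> smooth_on T f"
  unfolding smooth_on_def using Ck_on_subset by metis

lemma smooth_on_const: "open S \<Longrightarrow> smooth_on S (\<lambda>x. c)"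
  unfolding smooth_on_def by (simp add: Ck_on_const)

lemma smooth_on_ident: "open S \<Longrightarrow> smooth_on S (\<lambda>x. x)"
  unfolding smooth_on_def by (simp add: Ck_on_ident)

lemma smooth_on_add:
  "open S \<Longrightarrow> smooth_on S f \<Longrightarrow> smooth_on S g \<Longrightarrow> smooth_on S (\<lambda>x. f x + g x)"
  unfolding smooth_on_def by (simp add: Ck_on_add)

lemma smooth_on_linear:
  "bounded_linear L \<Longrightarrow> open S \<Longrightarrow> smooth_on S f \<Longrightarrow> smooth_on S (\<lambda>x. L (f x))"
  unfolding smooth_on_def by (simp add: Ck_on_linear)

lemma smooth_on_bilinear:
  "bounded_bilinear bil \<Longrightarrow> open S \<Longrightarrow> smooth_on S f \<Longrightarrow> smooth_on S g
    \<Longrightarrow> smooth_on S (\<lambda>x. bil (f x) (g x))"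
  unfolding smooth_on_def by (simp add: Ck_on_bilinear)

lemmas smooth_on_mult = smooth_on_bilinear[OF bounded_bilinear_mult]

lemma smooth_on_sum:
  "open S \<Longrightarrow> (\<And>i. i \<in> B \<Longrightarrow> smooth_on S (f i)) \<Longrightarrow> smooth_on S (\<lambda>x. \<Sum>i\<in>B. f i x)"
  unfolding smooth_on_def by (simp add: Ck_on_sum)

lemma smooth_on_compose:
  fixes g :: "'e::real_normed_vector \<Rightarrow> 'f::euclidean_space"
  assumes "open S" "open T" "g ` S \<subseteq> T" "smooth_on S g" "smooth_on T f"
  shows "smooth_on S (\<lambda>x. f (g x))"
  using Ck_on_compose[OF assms(1-3)] assms(4,5) unfolding smooth_on_def by blast

lemma smooth_on_cong:
  "open S \<Longrightarrow> (\<And>y. y \<in> S \<Longrightarrow> f y = g y) \<Longrightarrow> smooth_on S f \<longleftrightarrow> smooth_on S g"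
  unfolding smooth_on_def using Ck_on_cong by metis

lemma smooth_on_frechet_derivative:
  "smooth_on S f \<Longrightarrow> smooth_on S (\<lambda>x. frechet_derivative f (at x) v)"
  unfolding smooth_on_def by (simp add: Ck_on_frechet_derivative)

lemma smooth_on_has_derivative:
  "smooth_on S f \<Longrightarrow> x \<in> S \<Longrightarrow> (f has_derivative frechet_derivative f (at x)) (at x)"
  unfolding smooth_on_def by (meson Ck_on_SucE)

lemma smooth_on_continuous_on: "smooth_on S f \<Longrightarrow> continuous_on S f"
  unfolding smooth_on_def by (metis Ck_on.simps(1))

section \<open>Parameter integrals and Hadamard's lemma\<close>

lemma Ck_on_continuous_on: "Ck_on k S f \<Longrightarrow> continuous_on S f"
  by (induction k) (auto dest: Ck_on_SucD)

text \<open>The power of \<open>t\<close> is there for the induction: each differentiation under the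
  integral sign produces one more factor \<open>t\<close> by the chain rule, so all \<open>m\<close>
  must be treated at once. Convexity keeps the segments inside \<open>S\<close>.\<close>

lemma Ck_on_segment_integral:
  fixes F :: "'e::euclidean_space \<Rightarrow> real"
  assumes S: "open S" "convex S" "y0 \<in> S" and "Ck_on k S F"
  shows "Ck_on k S (\<lambda>y. integral {0..1} (\<lambda>t. t ^ m * F (y0 + t *\<^sub>R (y - y0))))"
  using assms(4)
proof (induction k arbitrary: F m)
  case 0
  have seg: "y0 + t *\<^sub>R (y - y0) \<in> S" if "y \<in> S" "t \<in> {0..1}" for y t
    using convexD_alt[OF S(2,3) that(1), of t] that(2) by (simp add: algebra_simps)
  have "continuous_on S (\<lambda>y. integral (cbox 0 1) (\<lambda>t. t ^ m * F (y0 + t *\<^sub>R (y - y0))))"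
    by (rule integral_continuous_on_param)
      (use seg 0 in \<open>auto simp: split_beta intro!: continuous_intros continuous_on_compose2[of S F]\<close>)
  then show ?case by (simp add: cbox_interval)
next
  case (Suc k)
  have seg: "y0 + t *\<^sub>R (y - y0) \<in> S" if "y \<in> S" "t \<in> {0..1}" for y t
    using convexD_alt[OF S(2,3) that(1), of t] that(2) by (simp add: algebra_simps)
  let ?D = "\<lambda>y. frechet_derivative F (at y)"
  \<comment> \<open>The Leibniz rule wants the derivative as a continuous family of bounded linear
    maps. In finite dimension this continuity may be checked one direction at a time.\<close>
  let ?fx = "\<lambda>y t. Blinfun (\<lambda>v. t ^ Suc m * ?D (y0 + t *\<^sub>R (y - y0)) v)"
  have bl: "bounded_linear (?D y)" if "y \<in> S" for y
    using Ck_on_SucE[OF Suc.prems that] by (rule has_derivative_bounded_linear)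
  have fx: "blinfun_apply (?fx y t) = (\<lambda>v. t ^ Suc m * ?D (y0 + t *\<^sub>R (y - y0)) v)"
    if "y \<in> S" "t \<in> {0..1}" for y t
    by (rule bounded_linear_Blinfun_apply)
      (intro bounded_linear_const_mult bl seg that)
  have contF: "continuous_on S F"
    using Suc.prems by (rule Ck_on_continuous_on)
  have contD: "continuous_on S (\<lambda>y. ?D y v)" for v
    using Ck_on_frechet_derivative[OF Suc.prems] by (rule Ck_on_continuous_on)
  show ?case
  proof (rule Ck_on_SucI[where f' = "\<lambda>v y. integral {0..1} (\<lambda>t. t ^ Suc m * ?D (y0 + t *\<^sub>R (y - y0)) v)"])
    fix y assume y: "y \<in> S"
    have cont: "continuous_on (S \<times> cbox 0 1) (\<lambda>(y, t). ?fx y t)"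
    proof (rule continuous_on_blinfun_componentwise)
      fix v :: 'e
      have "continuous_on (S \<times> cbox 0 1) (\<lambda>x. snd x ^ Suc m * ?D (y0 + snd x *\<^sub>R (fst x - y0)) v)"
        by (intro continuous_intros continuous_on_compose2[OF contD]) (auto intro!: seg)
      then show "continuous_on (S \<times> cbox 0 1) (\<lambda>x. blinfun_apply (case x of (y, t) \<Rightarrow> ?fx y t) v)"
        by (rule continuous_on_cong[THEN iffD1, rotated -1])
          (auto simp: fx simp del: power_Suc)
    qed
    have "((\<lambda>y. integral (cbox 0 1) (\<lambda>t. t ^ m * F (y0 + t *\<^sub>R (y - y0)))) has_derivative
        blinfun_apply (integral (cbox 0 1) (?fx y))) (at y within S)"
    proof (rule leibniz_rule[OF _ _ cont y S(2)])
      fix z t assume z: "z \<in> S" and t: "t \<in> cbox (0::real) 1"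
      then have t': "t \<in> {0..1}" by simp
      have aff: "((\<lambda>z. y0 + t *\<^sub>R (z - y0)) has_derivative (\<lambda>v. t *\<^sub>R v)) (at z)"
        by (auto intro!: derivative_eq_intros)
      have "((\<lambda>z. t ^ m * F (y0 + t *\<^sub>R (z - y0))) has_derivative
          (\<lambda>v. t ^ m * ?D (y0 + t *\<^sub>R (z - y0)) (t *\<^sub>R v))) (at z)"
        using has_derivative_compose[OF aff Ck_on_SucE[OF Suc.prems seg[OF z t']]]
        by (rule has_derivative_mult_right)
      then show "((\<lambda>z. t ^ m * F (y0 + t *\<^sub>R (z - y0))) has_derivative blinfun_apply (?fx z t))
          (at z within S)"
        using fx[OF z t'] linear_scale[OF bounded_linear.linear[OF bl[OF seg[OF z t']]]]
        by (auto simp: mult_ac intro: has_derivative_at_withinI)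
    next
      fix z assume z: "z \<in> S"
      show "(\<lambda>t. t ^ m * F (y0 + t *\<^sub>R (z - y0))) integrable_on cbox 0 1"
        by (intro integrable_continuous continuous_intros continuous_on_compose2[OF contF])
          (auto intro!: seg z)
    qed
    moreover have "blinfun_apply (integral (cbox 0 1) (?fx y)) v
        = integral {0..1} (\<lambda>t. t ^ Suc m * ?D (y0 + t *\<^sub>R (y - y0)) v)" for v
    proof -
      have "continuous_on (cbox 0 1) (\<lambda>t. (\<lambda>(y, t). ?fx y t) (y, t))"
        by (rule continuous_on_compose2[OF cont]) (use y in \<open>auto intro!: continuous_intros\<close>)
      then have "?fx y integrable_on cbox 0 1"
        unfolding prod.case by (rule integrable_continuous)
      then have "blinfun_apply (integral (cbox 0 1) (?fx y)) v
          = integral (cbox 0 1) (\<lambda>t. blinfun_apply (?fx y t) v)"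
        by (rule blinfun_apply_integral)
      also have "\<dots> = integral (cbox 0 1) (\<lambda>t. t ^ Suc m * ?D (y0 + t *\<^sub>R (y - y0)) v)"
        by (rule integral_cong) (simp only: fx[OF y] cbox_interval)
      finally show ?thesis by (simp add: cbox_interval)
    qed
    then have "blinfun_apply (integral (cbox 0 1) (?fx y))
        = (\<lambda>v. integral {0..1} (\<lambda>t. t ^ Suc m * ?D (y0 + t *\<^sub>R (y - y0)) v))" by (rule ext)
    ultimately show "((\<lambda>y. integral {0..1} (\<lambda>t. t ^ m * F (y0 + t *\<^sub>R (y - y0)))) has_derivative
        (\<lambda>v. integral {0..1} (\<lambda>t. t ^ Suc m * ?D (y0 + t *\<^sub>R (y - y0)) v))) (at y)"
      using at_within_open[OF y S(1)] by (simp only: cbox_interval)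
  next
    fix v
    show "Ck_on k S (\<lambda>y. integral {0..1} (\<lambda>t. t ^ Suc m * ?D (y0 + t *\<^sub>R (y - y0)) v))"
      using Ck_on_frechet_derivative[OF Suc.prems] by (rule Suc.IH)
  qed (rule S)
qed

text \<open>The fundamental theorem of calculus along the segment from \<open>y0\<close> to
  \<open>y\<close>; \<open>G b\<close> averages the partial derivative in direction \<open>b\<close>
  over that segment. At \<open>y = y0\<close> the integrand is constant, which gives the value of
  \<open>G b\<close> there.\<close>

lemma Hadamard:
  fixes F :: "'e::euclidean_space \<Rightarrow> real"
  assumes S: "open S" "convex S" "y0 \<in> S" and F: "smooth_on S F"
  obtains G where "\<And>b. smooth_on S (G b)" "\<And>b. G b y0 = frechet_derivative F (at y0) b"
    and "\<And>y. y \<in> S \<Longrightarrow> F y = F y0 + (\<Sum>b\<in>Basis. ((y - y0) \<bullet> b) * G b y)"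
proof
  define G where "G = (\<lambda>b y. integral {0..1} (\<lambda>t. frechet_derivative F (at (y0 + t *\<^sub>R (y - y0))) b))"
  show "smooth_on S (G b)" for b
    using Ck_on_segment_integral[OF S, where m = 0 and F = "\<lambda>y. frechet_derivative F (at y) b"]
      smooth_on_frechet_derivative[OF F, of b]
    unfolding smooth_on_def G_def by simp
  show "G b y0 = frechet_derivative F (at y0) b" for b
    by (simp add: G_def)
  fix y assume y: "y \<in> S"
  have seg: "y0 + t *\<^sub>R (y - y0) \<in> S" if "t \<in> {0..1}" for t
    using convexD_alt[OF S(2,3) y, of t] that by (simp add: algebra_simps)
  let ?D = "\<lambda>t. frechet_derivative F (at (y0 + t *\<^sub>R (y - y0)))"
  have lin: "linear (?D t)" if "t \<in> {0..1}" for t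
    using smooth_on_has_derivative[OF F seg[OF that]] by (rule has_derivative_linear)
  have "((\<lambda>t. F (y0 + t *\<^sub>R (y - y0))) has_vector_derivative ?D t (y - y0)) (at t within {0..1})"
    if t: "t \<in> {0..1}" for t
  proof -
    have aff: "((\<lambda>t. y0 + t *\<^sub>R (y - y0)) has_derivative (\<lambda>s. s *\<^sub>R (y - y0))) (at t)"
      by (auto intro!: derivative_eq_intros)
    have "((\<lambda>t. F (y0 + t *\<^sub>R (y - y0))) has_derivative (\<lambda>s. ?D t (s *\<^sub>R (y - y0)))) (at t)"
      using has_derivative_compose[OF aff smooth_on_has_derivative[OF F seg[OF t]]] .
    then show ?thesis
      unfolding has_vector_derivative_def linear_scale[OF lin[OF t]]
      by (rule has_derivative_at_withinI)
  qed
  then have "((\<lambda>t. ?D t (y - y0)) has_integral F (y0 + 1 *\<^sub>R (y - y0)) - F (y0 + 0 *\<^sub>R (y - y0))) {0..1}"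
    by (intro fundamental_theorem_of_calculus) auto
  then have "F y - F y0 = integral {0..1} (\<lambda>t. ?D t (y - y0))"
    by (simp add: integral_unique)
  also have "\<dots> = integral {0..1} (\<lambda>t. \<Sum>b\<in>Basis. ((y - y0) \<bullet> b) * ?D t b)"
    unfolding real_scaleR_def[symmetric] by (rule integral_cong, rule linear_euclidean_sum[OF lin])
  also have "\<dots> = (\<Sum>b\<in>Basis. integral {0..1} (\<lambda>t. ((y - y0) \<bullet> b) * ?D t b))"
    by (intro integral_sum integrable_continuous_real continuous_intros
        continuous_on_compose2[OF smooth_on_continuous_on[OF smooth_on_frechet_derivative[OF F]]])
      (auto intro: seg)
  finally show "F y = F y0 + (\<Sum>b\<in>Basis. ((y - y0) \<bullet> b) * G b y)"
    by (simp add: G_def)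
qed

section \<open>Smooth functions of time and space, mixed partial derivatives\<close>

lemma smooth_on_slice:
  fixes F :: "real \<times> 'e::euclidean_space \<Rightarrow> real"
  assumes "smooth_on (I \<times> S) F" "t \<in> I" "open I" "open S"
  shows "smooth_on S (\<lambda>y. F (t, y))"
proof (rule smooth_on_compose[OF assms(4) open_Times[OF assms(3,4)] _ _ assms(1)])
  have "bounded_linear (\<lambda>y::'e. (0::real, y))"
    by (intro bounded_linear_Pair bounded_linear_zero bounded_linear_ident)
  from smooth_on_add[OF assms(4) smooth_on_const[OF assms(4), of "(t, 0)"]
      smooth_on_linear[OF this assms(4) smooth_on_ident[OF assms(4)]]]
  have "smooth_on S (\<lambda>y. (t, 0) + (0, y))" .
  then show "smooth_on S (Pair t)" by simp
qed (use assms in auto)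

text \<open>Both partial derivatives are values of the total derivative, so their joint smoothness
  is inherited from \<open>F\<close>.\<close>

lemma smooth_on_partials:
  fixes F :: "real \<times> 'e::euclidean_space \<Rightarrow> real"
  assumes F: "smooth_on (I \<times> S) F" and "t \<in> I" "y \<in> S"
  shows "((\<lambda>s. F (s, y)) has_real_derivative frechet_derivative F (at (t, y)) (1, 0)) (at t)"
    and "frechet_derivative (\<lambda>y. F (t, y)) (at y) v = frechet_derivative F (at (t, y)) (0, v)"
proof -
  let ?D = "frechet_derivative F (at (t, y))"
  have D: "(F has_derivative ?D) (at (t, y))"
    using F assms by (auto intro: smooth_on_has_derivative)
  have aff1: "((\<lambda>s. (s, y)) has_derivative (\<lambda>h. (h, 0))) (at t)"
    and aff2: "(Pair t has_derivative Pair 0) (at y)"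
    by (auto intro!: derivative_eq_intros)
  have "((\<lambda>s. F (s, y)) has_derivative (\<lambda>h. ?D (h, 0))) (at t)"
    using has_derivative_compose[OF aff1 D] .
  moreover have "?D (h, 0) = ?D (1, 0) * h" for h
    using linear_scale[OF has_derivative_linear[OF D], of h "(1, 0)"] by simp
  then have "(\<lambda>h. ?D (h, 0)) = (*) (?D (1, 0))" by (rule ext)
  ultimately show "((\<lambda>s. F (s, y)) has_real_derivative ?D (1, 0)) (at t)"
    by (simp only: has_field_derivative_def)
  have "((\<lambda>y. F (t, y)) has_derivative (\<lambda>v. ?D (0, v))) (at y)"
    using has_derivative_compose[OF aff2 D] .
  then show "frechet_derivative (\<lambda>y. F (t, y)) (at y) v = ?D (0, v)"
    using frechet_derivative_at by metis
qed

text \<open>Integrating \<open>H\<close>, the time derivative of \<open>F\<close>, recovers the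
  increment of \<open>F\<close> in time. Differentiating this integral first in direction
  \<open>v\<close> and then in its upper limit gives the time derivative of the space
  derivative.\<close>

lemma smooth_on_mixed_partials:
  fixes F :: "real \<times> 'e::euclidean_space \<Rightarrow> real"
  assumes F: "smooth_on (I \<times> S) F" and "open I" "open S" and t: "t \<in> I" and y: "y \<in> S"
  shows "((\<lambda>s. frechet_derivative (\<lambda>y. F (s, y)) (at y) v) has_real_derivative
     frechet_derivative (\<lambda>y. frechet_derivative F (at (t, y)) (1, 0)) (at y) v) (at t)"
proof -
  define H where "H = (\<lambda>z. frechet_derivative F (at z) (1, 0))"
  have H: "smooth_on (I \<times> S) H"
    unfolding H_def by (rule smooth_on_frechet_derivative[OF F])
  define K where "K = (\<lambda>z. frechet_derivative F (at z) (0, v))"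
  define L where "L = (\<lambda>z. frechet_derivative H (at z) (0, v))"
  have contH: "continuous_on (I \<times> S) H" and contL: "continuous_on (I \<times> S) L"
    unfolding L_def using H by (auto intro: smooth_on_continuous_on smooth_on_frechet_derivative)
  obtain e where e: "e > 0" "cball t e \<subseteq> I"
    using \<open>open I\<close> t open_contains_cball by blast
  have I': "{t - e..t + e} \<subseteq> I"
    using e(2) by (simp add: cball_eq_atLeastAtMost)
  \<comment> \<open>Restricting to the line through \<open>y\<close> in direction \<open>v\<close>
    makes the space derivative an ordinary one at \<open>r = 0\<close>. The ball found below is a
    convex set of parameters, as the Leibniz rule asks.\<close>
  define U where "U = {r. y + r *\<^sub>R v \<in> S}"
  have "open U"
    unfolding U_def using open_vimage[OF \<open>open S\<close>, of "\<lambda>r. y + r *\<^sub>R v"]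
    by (simp add: vimage_def continuous_intros)
  moreover have "0 \<in> U"
    using y by (simp add: U_def)
  ultimately obtain d where d: "d > 0" "ball 0 d \<subseteq> U"
    using open_contains_ball by blast
  have line: "y + r *\<^sub>R v \<in> S" if "r \<in> ball 0 d" for r
    using d(2) that by (auto simp: U_def)
  have partial_r: "((\<lambda>r. f (s, y + r *\<^sub>R v)) has_real_derivative
      frechet_derivative f (at (s, y + r *\<^sub>R v)) (0, v)) (at r)"
    if f: "smooth_on (I \<times> S) f" and "s \<in> I" "r \<in> ball 0 d" for f :: "real \<times> 'e \<Rightarrow> real" and s r
  proof -
    let ?D = "frechet_derivative f (at (s, y + r *\<^sub>R v))"
    have D: "(f has_derivative ?D) (at (s, y + r *\<^sub>R v))"
      using that line by (intro smooth_on_has_derivative[OF f]) auto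
    have aff: "((\<lambda>r. (s, y + r *\<^sub>R v)) has_derivative (\<lambda>h. (0, h *\<^sub>R v))) (at r)"
      by (auto intro!: derivative_eq_intros)
    have "((\<lambda>r. f (s, y + r *\<^sub>R v)) has_derivative (\<lambda>h. ?D (0, h *\<^sub>R v))) (at r)"
      using has_derivative_compose[OF aff D] .
    moreover have "?D (0, h *\<^sub>R v) = ?D (0, v) * h" for h
      using linear_scale[OF has_derivative_linear[OF D], of h "(0, v)"] by simp
    then have "(\<lambda>h. ?D (0, h *\<^sub>R v)) = (*) (?D (0, v))" by (rule ext)
    ultimately show ?thesis
      by (simp only: has_field_derivative_def)
  qed
  \<comment> \<open>The increment of \<open>F\<close> between \<open>t - e\<close> and
    \<open>s\<close> is differentiated at \<open>r = 0\<close> twice, under the integral and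
    directly; uniqueness of derivatives compares the results.\<close>
  have Keq: "K (s, y) = K (t - e, y) + integral {t - e..s} (\<lambda>\<sigma>. L (\<sigma>, y))"
    if s: "s \<in> {t - e..t + e}" for s
  proof -
    have sub: "{t - e..s} \<subseteq> I" using s I' by auto
    have int: "integral (cbox (t - e) s) (\<lambda>\<sigma>. H (\<sigma>, y + r *\<^sub>R v))
        = F (s, y + r *\<^sub>R v) - F (t - e, y + r *\<^sub>R v)" if "r \<in> ball 0 d" for r
    proof -
      have "((\<lambda>\<sigma>. H (\<sigma>, y + r *\<^sub>R v)) has_integral
          F (s, y + r *\<^sub>R v) - F (t - e, y + r *\<^sub>R v)) {t - e..s}"
      proof (rule fundamental_theorem_of_calculus)
        fix \<sigma> assume "\<sigma> \<in> {t - e..s}"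
        then have "\<sigma> \<in> I" using sub by blast
        then show "((\<lambda>\<sigma>. F (\<sigma>, y + r *\<^sub>R v)) has_vector_derivative H (\<sigma>, y + r *\<^sub>R v))
            (at \<sigma> within {t - e..s})"
          using smooth_on_partials(1)[OF F _ line[OF that]]
          unfolding H_def has_real_derivative_iff_has_vector_derivative
          by (blast intro: has_vector_derivative_at_within)
      qed (use s in simp)
      then show ?thesis by (simp add: integral_unique)
    qed
    have "((\<lambda>r. integral (cbox (t - e) s) (\<lambda>\<sigma>. H (\<sigma>, y + r *\<^sub>R v))) has_real_derivative
        integral (cbox (t - e) s) (\<lambda>\<sigma>. L (\<sigma>, y + 0 *\<^sub>R v))) (at 0 within ball 0 d)"
    proof (rule leibniz_rule_field_derivative)
      show "((\<lambda>r. H (\<sigma>, y + r *\<^sub>R v)) has_real_derivative L (\<sigma>, y + r *\<^sub>R v)) (at r within ball 0 d)"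
        if "r \<in> ball 0 d" "\<sigma> \<in> cbox (t - e) s" for r \<sigma>
        unfolding L_def
        by (rule has_field_derivative_at_within[OF partial_r[OF H]]) (use that sub in auto)
      show "(\<lambda>\<sigma>. H (\<sigma>, y + r *\<^sub>R v)) integrable_on cbox (t - e) s" if "r \<in> ball 0 d" for r
        by (intro integrable_continuous continuous_on_compose2[OF contH] continuous_intros)
          (use line[OF that] sub in auto)
      show "continuous_on (ball 0 d \<times> cbox (t - e) s) (\<lambda>(r, \<sigma>). L (\<sigma>, y + r *\<^sub>R v))"
        unfolding split_beta
        by (intro continuous_on_compose2[OF contL] continuous_intros) (use line sub in auto)
    qed (use d in auto)
    then have "((\<lambda>r. integral (cbox (t - e) s) (\<lambda>\<sigma>. H (\<sigma>, y + r *\<^sub>R v))) has_real_derivative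
        integral {t - e..s} (\<lambda>\<sigma>. L (\<sigma>, y))) (at 0)"
      using at_within_open[OF centre_in_ball[THEN iffD2, OF d(1)] open_ball, of "0::real"]
      by (simp only: cbox_interval scaleR_zero_left add_0_right)
    then have "((\<lambda>r. F (s, y + r *\<^sub>R v) - F (t - e, y + r *\<^sub>R v)) has_real_derivative
        integral {t - e..s} (\<lambda>\<sigma>. L (\<sigma>, y))) (at 0)"
      by (rule has_field_derivative_transform_within_open[where S = "ball 0 d"]) (use d(1) int in auto)
    moreover have "((\<lambda>r. F (s, y + r *\<^sub>R v) - F (t - e, y + r *\<^sub>R v)) has_real_derivative
        K (s, y) - K (t - e, y)) (at 0)"
    proof -
      have "s \<in> I" "t - e \<in> I" using s I' e(1) by auto
      then show ?thesis
        using partial_r[OF F, of s 0] partial_r[OF F, of "t - e" 0] d(1)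
        unfolding K_def by (intro DERIV_diff) auto
    qed
    ultimately show ?thesis using DERIV_unique by fastforce
  qed
  have "((\<lambda>s. integral {t - e..s} (\<lambda>\<sigma>. L (\<sigma>, y))) has_real_derivative L (t, y))
      (at t within {t - e..t + e})"
    by (rule integral_has_real_derivative)
      (use e(1) I' y in \<open>auto intro!: continuous_on_compose2[OF contL] continuous_intros\<close>)
  then have "((\<lambda>s. integral {t - e..s} (\<lambda>\<sigma>. L (\<sigma>, y))) has_real_derivative L (t, y)) (at t)"
    using e(1) at_within_Icc_at[of "t - e" t "t + e"] by (simp only: less_add_same_cancel1 diff_less_eq)
  then have "((\<lambda>s. K (t - e, y) + integral {t - e..s} (\<lambda>\<sigma>. L (\<sigma>, y))) has_real_derivative L (t, y)) (at t)"
    by (auto intro!: derivative_eq_intros)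
  then have "((\<lambda>s. frechet_derivative (\<lambda>y. F (s, y)) (at y) v) has_real_derivative L (t, y)) (at t)"
  proof (rule has_field_derivative_transform_within_open[where S = "{t - e<..<t + e}"])
    fix s assume "s \<in> {t - e<..<t + e}"
    then have "s \<in> {t - e..t + e}" by auto
    then show "K (t - e, y) + integral {t - e..s} (\<lambda>\<sigma>. L (\<sigma>, y)) = frechet_derivative (\<lambda>y. F (s, y)) (at y) v"
      using smooth_on_partials(2)[OF F _ y] I' Keq by (metis K_def subsetD)
  qed (use e(1) in auto)
  moreover have "L (t, y) = frechet_derivative (\<lambda>y. H (t, y)) (at y) v"
    unfolding L_def using smooth_on_partials(2)[OF H t y] by simp
  ultimately show ?thesis by (simp add: H_def)
qed

lemma sum_Basis_vec:
  fixes h :: "real ^ 'm::finite \<Rightarrow> real"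
  shows "(\<Sum>b\<in>Basis. h b) = (\<Sum>i\<in>UNIV. h (axis i 1))"
proof -
  have inj: "inj (\<lambda>i :: 'm. axis i (1::real))"
    by (simp add: inj_on_def axis_eq_axis)
  have "(Basis :: (real ^ 'm) set) = range (\<lambda>i. axis i 1)"
    by (auto simp: Basis_vec_def)
  then show ?thesis using sum.reindex[OF inj, of h] by (simp add: comp_def)
qed

section \<open>Smooth functions on a manifold\<close>

locale smooth_atlas =
  fixes A :: "('a::topological_space, 'm::finite) chart set"
  assumes atlas: "oriented_atlas A"
begin

lemma is_chart: "c \<in> A \<Longrightarrow> is_chart c"
  using atlas by (simp add: oriented_atlas_def)

lemma chart_at:
  obtains c where "c \<in> A" "q \<in> fst c"
  using atlas unfolding oriented_atlas_def by blast

lemma open_chart_domain [simp]: "c \<in> A \<Longrightarrow> open (fst c)"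
  using is_chart by (simp add: is_chart_def)

lemma chart_inv_left [simp]: "c \<in> A \<Longrightarrow> x \<in> fst c \<Longrightarrow> chart_inv c (snd c x) = x"
  using is_chart by (fastforce simp: is_chart_def homeomorphism_def)

lemma chart_inv_right: "c \<in> A \<Longrightarrow> y \<in> snd c ` fst c \<Longrightarrow> snd c (chart_inv c y) = y"
  using is_chart by (fastforce simp: is_chart_def homeomorphism_def)

lemma chart_inv_mem: "c \<in> A \<Longrightarrow> y \<in> snd c ` fst c \<Longrightarrow> chart_inv c y \<in> fst c"
  by force

lemma open_chart_image:
  assumes "c \<in> A" "open U"
  shows "open (snd c ` (U \<inter> fst c))"
proof -
  have "homeomorphism (fst c) (snd c ` fst c) (snd c) (chart_inv c)"
    using is_chart[OF assms(1)] by (simp add: is_chart_def)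
  moreover have "openin (top_of_set (fst c)) (U \<inter> fst c)"
    using assms(2) by (metis openin_open_Int inf_commute)
  ultimately have "openin (top_of_set (snd c ` fst c)) (snd c ` (U \<inter> fst c))"
    by (rule homeomorphism_imp_open_map)
  moreover have "open (snd c ` fst c)"
    using is_chart[OF assms(1)] by (simp add: is_chart_def)
  ultimately show ?thesis
    using openin_open_trans by blast
qed

lemma open_chart_preimage:
  assumes "c \<in> A" "open U" "open B"
  shows "open (U \<inter> fst c \<inter> snd c -` B)"
proof -
  have "continuous_on (fst c) (snd c)"
    using is_chart[OF assms(1)] by (simp add: is_chart_def homeomorphism_def)
  then have "continuous_on (U \<inter> fst c) (snd c)"
    by (rule continuous_on_subset) simp
  then show ?thesis
    using assms by (simp add: continuous_on_open_vimage vimage_def Int_commute open_Int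
        continuous_open_preimage flip: vimage_def)
qed

lemma smooth_transition:
  assumes "c \<in> A" "d \<in> A"
  shows "smooth_on (snd c ` (fst c \<inter> fst d)) (\<lambda>y. snd d (chart_inv c y))"
  using atlas assms unfolding oriented_atlas_def comp_def by blast

lemma smooth_fun_subset: "smooth_fun A U f \<Longrightarrow> V \<subseteq> U \<Longrightarrow> smooth_fun A V f"
  unfolding smooth_fun_def by (meson smooth_on_subset image_mono Int_mono subset_refl)

lemma smooth_fun_cong:
  assumes "open U" "\<And>x. x \<in> U \<Longrightarrow> f x = g x"
  shows "smooth_fun A U f \<longleftrightarrow> smooth_fun A U g"
proof -
  have "smooth_on (snd c ` (U \<inter> fst c)) (f \<circ> chart_inv c)
      \<longleftrightarrow> smooth_on (snd c ` (U \<inter> fst c)) (g \<circ> chart_inv c)" if "c \<in> A" for c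
    using that assms by (intro smooth_on_cong open_chart_image) auto
  then show ?thesis by (simp add: smooth_fun_def)
qed

lemma smooth_fun_const: "open U \<Longrightarrow> smooth_fun A U (\<lambda>x. k)"
  by (simp add: smooth_fun_def comp_def smooth_on_const open_chart_image)

lemma smooth_fun_add:
  "open U \<Longrightarrow> smooth_fun A U f \<Longrightarrow> smooth_fun A U g \<Longrightarrow> smooth_fun A U (\<lambda>x. f x + g x)"
  by (simp add: smooth_fun_def comp_def smooth_on_add open_chart_image)

lemma smooth_fun_mult:
  "open U \<Longrightarrow> smooth_fun A U f \<Longrightarrow> smooth_fun A U g \<Longrightarrow> smooth_fun A U (\<lambda>x. f x * g x)"
  by (simp add: smooth_fun_def comp_def smooth_on_mult open_chart_image)

lemma smooth_fun_diff:
  assumes "open U" "smooth_fun A U f" "smooth_fun A U g"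
  shows "smooth_fun A U (\<lambda>x. f x - g x)"
  using smooth_fun_add[OF assms(1,2) smooth_fun_mult[OF assms(1) smooth_fun_const[OF assms(1), of "-1"] assms(3)]]
  by simp

text \<open>Smoothness is demanded in every chart of the atlas. On a set inside the domain of
  \<open>c\<close>, any other chart only adds a transition map, composed with \<open>f\<close> as
  read in \<open>c\<close>.\<close>

lemma smooth_fun_chartI:
  assumes c: "c \<in> A" and U: "open U" "U \<subseteq> fst c"
    and f: "smooth_on (snd c ` U) (\<lambda>y. f (chart_inv c y))"
  shows "smooth_fun A U f"
  unfolding smooth_fun_def
proof
  fix d assume d: "d \<in> A"
  let ?W = "snd d ` (U \<inter> fst d)"
  have W: "open ?W" using d U by (intro open_chart_image)
  have cU: "open (snd c ` U)" using open_chart_image[OF c U(1)] U(2) by (simp add: Int_absorb2)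
  have "smooth_on ?W (\<lambda>y. snd c (chart_inv d y))"
    by (rule smooth_on_subset[OF smooth_transition[OF d c]]) (use U(2) in auto)
  moreover have "(\<lambda>y. snd c (chart_inv d y)) ` ?W \<subseteq> snd c ` U"
    using d by auto
  ultimately have "smooth_on ?W (\<lambda>y. f (chart_inv c (snd c (chart_inv d y))))"
    using smooth_on_compose[OF W cU _ _ f] by blast
  moreover have "chart_inv c (snd c (chart_inv d y)) = chart_inv d y" if "y \<in> ?W" for y
    using that c d U(2) by auto
  ultimately show "smooth_on ?W (f \<circ> chart_inv d)"
    using smooth_on_cong[OF W, of "\<lambda>y. f (chart_inv c (snd c (chart_inv d y)))" "f \<circ> chart_inv d"]
    by simp
qed

lemma smooth_fun_chartD:
  assumes "c \<in> A" "U \<subseteq> fst c" "smooth_fun A U f"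
  shows "smooth_on (snd c ` U) (\<lambda>y. f (chart_inv c y))"
  using assms unfolding smooth_fun_def comp_def by (metis Int_absorb2)

text \<open>Carries functions on coordinate space, such as partial derivatives or the coefficients
  from Hadamard's lemma, over to the manifold.\<close>

lemma smooth_fun_via_chart:
  assumes c: "c \<in> A" and U: "open U" "U \<subseteq> fst c" and F: "smooth_on (snd c ` U) F"
  shows "smooth_fun A U (\<lambda>x. F (snd c x))"
proof (rule smooth_fun_chartI[OF c U])
  have "open (snd c ` U)" using open_chart_image[OF c U(1)] U(2) by (simp add: Int_absorb2)
  then show "smooth_on (snd c ` U) (\<lambda>y. F (snd c (chart_inv c y)))"
    using F chart_inv_right[OF c] U(2) smooth_on_cong[of "snd c ` U" "\<lambda>y. F (snd c (chart_inv c y))" F]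
    by (metis image_mono subsetD)
qed

lemma smooth_fun_coord:
  assumes c: "c \<in> A"
  shows "smooth_fun A (fst c) (\<lambda>x. snd c x $ i)"
proof (rule smooth_fun_via_chart[OF c])
  have "open (snd c ` fst c)" using open_chart_image[OF c open_chart_domain[OF c]] by simp
  then show "smooth_on (snd c ` fst c) (\<lambda>y. y $ i)"
    by (intro smooth_on_linear[OF bounded_linear_vec_nth] smooth_on_ident)
qed (use c in auto)

lemma smooth_fun_partial:
  assumes c: "c \<in> A" and U: "open U" "U \<subseteq> fst c" and f: "smooth_fun A U f"
  shows "smooth_fun A U (\<lambda>x. frechet_derivative (f \<circ> chart_inv c) (at (snd c x)) w)"
proof -
  have "smooth_on (snd c ` U) (f \<circ> chart_inv c)"
    using smooth_fun_chartD[OF c U(2) f] by (simp add: comp_def)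
  from smooth_fun_via_chart[OF c U smooth_on_frechet_derivative[OF this]]
  show ?thesis .
qed

lemma smooth_nearI: "smooth_fun A U f \<Longrightarrow> open U \<Longrightarrow> q \<in> U \<Longrightarrow> smooth_near A q f"
  unfolding smooth_near_def by blast

lemma smooth_near_combine:
  assumes "smooth_near A q f" "smooth_near A q g"
  obtains U where "open U" "q \<in> U" "smooth_fun A U f" "smooth_fun A U g"
proof -
  obtain U V where "open U" "q \<in> U" "smooth_fun A U f" "open V" "q \<in> V" "smooth_fun A V g"
    using assms unfolding smooth_near_def by blast
  then show thesis
    by (intro that[of "U \<inter> V"]) (auto intro: smooth_fun_subset)
qed

lemma smooth_near_const: "smooth_near A q (\<lambda>x. k)"
  by (rule smooth_nearI[OF smooth_fun_const open_UNIV]) auto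

lemma smooth_near_add:
  "smooth_near A q f \<Longrightarrow> smooth_near A q g \<Longrightarrow> smooth_near A q (\<lambda>x. f x + g x)"
  by (erule (1) smooth_near_combine) (blast intro: smooth_nearI smooth_fun_add)

lemma smooth_near_mult:
  "smooth_near A q f \<Longrightarrow> smooth_near A q g \<Longrightarrow> smooth_near A q (\<lambda>x. f x * g x)"
  by (erule (1) smooth_near_combine) (blast intro: smooth_nearI smooth_fun_mult)

lemma smooth_near_diff:
  "smooth_near A q f \<Longrightarrow> smooth_near A q g \<Longrightarrow> smooth_near A q (\<lambda>x. f x - g x)"
  by (erule (1) smooth_near_combine) (blast intro: smooth_nearI smooth_fun_diff)

lemma smooth_near_sum:
  "(\<And>i. i \<in> B \<Longrightarrow> smooth_near A q (f i)) \<Longrightarrow> smooth_near A q (\<lambda>x. \<Sum>i\<in>B. f i x)"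
  by (induction B rule: infinite_finite_induct) (auto intro: smooth_near_const smooth_near_add)

lemma smooth_near_coord: "c \<in> A \<Longrightarrow> q \<in> fst c \<Longrightarrow> smooth_near A q (\<lambda>x. snd c x $ i)"
  by (rule smooth_nearI[OF smooth_fun_coord]) auto

lemma smooth_near_cong:
  assumes "\<forall>\<^sub>F x in nhds q. f x = g x" "smooth_near A q f"
  shows "smooth_near A q g"
proof -
  obtain V where "open V" "q \<in> V" "\<And>x. x \<in> V \<Longrightarrow> f x = g x"
    using assms(1) unfolding eventually_nhds by blast
  moreover obtain U where "open U" "q \<in> U" "smooth_fun A U f"
    using assms(2) unfolding smooth_near_def by blast
  ultimately have "smooth_fun A (U \<inter> V) g" "open (U \<inter> V)" "q \<in> U \<inter> V"
    using smooth_fun_cong[of "U \<inter> V" f g] by (auto intro: smooth_fun_subset)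
  then show ?thesis by (rule smooth_nearI)
qed

lemma smooth_near_differentiable:
  assumes "c \<in> A" "q \<in> fst c" "smooth_near A q f"
  shows "(f \<circ> chart_inv c has_derivative frechet_derivative (f \<circ> chart_inv c) (at (snd c q))) (at (snd c q))"
proof -
  obtain U where "open U" "q \<in> U" "smooth_fun A U f"
    using assms unfolding smooth_near_def by blast
  then have "smooth_on (snd c ` (U \<inter> fst c)) (f \<circ> chart_inv c)" "snd c q \<in> snd c ` (U \<inter> fst c)"
    using assms by (auto simp: smooth_fun_def)
  then show ?thesis by (rule smooth_on_has_derivative)
qed

section \<open>Tangent vectors\<close>

lemma tangent_spaceI:
  assumes "\<And>f. \<not> smooth_near A q f \<Longrightarrow> v f = 0"
    and "\<And>f g. smooth_near A q f \<Longrightarrow> smooth_near A q g \<Longrightarrow> \<forall>\<^sub>F x in nhds q. f x = g x \<Longrightarrow> v f = v g"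
    and "\<And>f g a b. smooth_near A q f \<Longrightarrow> smooth_near A q g
      \<Longrightarrow> v (\<lambda>x. a * f x + b * g x) = a * v f + b * v g"
    and "\<And>f g. smooth_near A q f \<Longrightarrow> smooth_near A q g
      \<Longrightarrow> v (\<lambda>x. f x * g x) = f q * v g + g q * v f"
  shows "v \<in> tangent_space A q"
  unfolding tangent_space_def mem_Collect_eq using assms by (intro conjI allI impI)

lemma tangent_not_smooth: "v \<in> tangent_space A q \<Longrightarrow> \<not> smooth_near A q f \<Longrightarrow> v f = 0"
  unfolding tangent_space_def by blast

lemma tangent_linear:
  "v \<in> tangent_space A q \<Longrightarrow> smooth_near A q f \<Longrightarrow> smooth_near A q g
    \<Longrightarrow> v (\<lambda>x. a * f x + b * g x) = a * v f + b * v g"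
  unfolding tangent_space_def by blast

lemma tangent_product:
  "v \<in> tangent_space A q \<Longrightarrow> smooth_near A q f \<Longrightarrow> smooth_near A q g
    \<Longrightarrow> v (\<lambda>x. f x * g x) = f q * v g + g q * v f"
  unfolding tangent_space_def by blast

text \<open>Smoothness near \<open>q\<close> depends only on the germ, so either both functions are
  smooth there or neither is; in the latter case both values are the default
  \<open>0\<close>.\<close>

lemma tangent_cong:
  assumes "v \<in> tangent_space A q" "\<forall>\<^sub>F x in nhds q. f x = g x"
  shows "v f = v g"
proof (cases "smooth_near A q f")
  case True
  with assms smooth_near_cong show ?thesis
    unfolding tangent_space_def by blast
next
  case False
  then have "\<not> smooth_near A q g"
    using smooth_near_cong[of g f q] assms(2) by (auto simp: eq_commute)
  with False assms tangent_not_smooth show ?thesis by metis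
qed

lemma tangent_add:
  "v \<in> tangent_space A q \<Longrightarrow> smooth_near A q f \<Longrightarrow> smooth_near A q g
    \<Longrightarrow> v (\<lambda>x. f x + g x) = v f + v g"
  using tangent_linear[of v q f g 1 1] by simp

lemma tangent_diff:
  "v \<in> tangent_space A q \<Longrightarrow> smooth_near A q f \<Longrightarrow> smooth_near A q g
    \<Longrightarrow> v (\<lambda>x. f x - g x) = v f - v g"
  using tangent_linear[of v q f g 1 "-1"] by simp

text \<open>The product rule at \<open>1 * 1\<close> gives \<open>v 1 = 2 * v 1\<close>.\<close>

lemma tangent_const:
  assumes "v \<in> tangent_space A q"
  shows "v (\<lambda>x. k) = 0"
proof -
  have "v (\<lambda>x. 1) = 0"
    using tangent_product[OF assms smooth_near_const[of q 1] smooth_near_const[of q 1]] by simp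
  then show ?thesis
    using tangent_linear[OF assms smooth_near_const[of q 1] smooth_near_const[of q 1], of k 0] by simp
qed

lemma tangent_sum:
  assumes "v \<in> tangent_space A q" "\<And>i. i \<in> B \<Longrightarrow> smooth_near A q (f i)"
  shows "v (\<lambda>x. \<Sum>i\<in>B. f i x) = (\<Sum>i\<in>B. v (f i))"
  using assms(2)
proof (induction B rule: infinite_finite_induct)
  case (insert i B)
  then have "v (\<lambda>x. f i x + (\<Sum>i\<in>B. f i x)) = v (f i) + v (\<lambda>x. \<Sum>i\<in>B. f i x)"
    by (intro tangent_add[OF assms(1)] smooth_near_sum) auto
  with insert show ?case by simp
qed (simp_all add: tangent_const[OF assms(1)])

lemma tangent_zero: "(\<lambda>f. 0) \<in> tangent_space A q"
  by (simp add: tangent_space_def)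

lemma tangent_space_linear:
  assumes v: "v \<in> tangent_space A q" and w: "w \<in> tangent_space A q"
  shows "(\<lambda>f. a * v f + b * w f) \<in> tangent_space A q"
proof (rule tangent_spaceI)
  fix f g :: "'a \<Rightarrow> real" and k l :: real
  assume f: "smooth_near A q f" and g: "smooth_near A q g"
  show "a * v (\<lambda>x. k * f x + l * g x) + b * w (\<lambda>x. k * f x + l * g x)
      = k * (a * v f + b * w f) + l * (a * v g + b * w g)"
    unfolding tangent_linear[OF v f g] tangent_linear[OF w f g] by (simp add: algebra_simps)
  show "a * v (\<lambda>x. f x * g x) + b * w (\<lambda>x. f x * g x)
      = f q * (a * v g + b * w g) + g q * (a * v f + b * w f)"
    unfolding tangent_product[OF v f g] tangent_product[OF w f g] by (simp add: algebra_simps)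
next
  fix f :: "'a \<Rightarrow> real" assume "\<not> smooth_near A q f"
  then show "a * v f + b * w f = 0"
    by (simp add: tangent_not_smooth[OF v] tangent_not_smooth[OF w])
next
  fix f g :: "'a \<Rightarrow> real" assume "\<forall>\<^sub>F x in nhds q. f x = g x"
  then show "a * v f + b * w f = a * v g + b * w g"
    using tangent_cong[OF v] tangent_cong[OF w] by metis
qed

lemma tangent_space_sum:
  "(\<And>i. i \<in> B \<Longrightarrow> v i \<in> tangent_space A q) \<Longrightarrow> (\<lambda>f. \<Sum>i\<in>B. a i * v i f) \<in> tangent_space A q"
proof (induction B rule: infinite_finite_induct)
  case (insert i B)
  then show ?case
    using tangent_space_linear[of "v i" q "\<lambda>f. \<Sum>i\<in>B. a i * v i f" "a i" 1] by simp
qed (auto simp: tangent_zero)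

lemma coord_vec_tangent:
  assumes c: "c \<in> A" and q: "q \<in> fst c"
  shows "coord_vec A c q i \<in> tangent_space A q"
proof -
  note D = smooth_near_differentiable[OF c q]
  let ?y = "snd c q" and ?e = "axis i 1 :: real ^ 'm"
  let ?fd = "\<lambda>f. frechet_derivative (f \<circ> chart_inv c) (at ?y) ?e"
  have sm: "coord_vec A c q i f = ?fd f" if "smooth_near A q f" for f
    using that by (simp add: coord_vec_def)
  have cong: "coord_vec A c q i f = coord_vec A c q i g"
    if f: "smooth_near A q f" and g: "smooth_near A q g"
      and fg: "\<forall>\<^sub>F x in nhds q. f x = g x" for f g
  proof -
    obtain V where V: "open V" "q \<in> V" "\<And>x. x \<in> V \<Longrightarrow> f x = g x"
      using fg unfolding eventually_nhds by blast
    have "frechet_derivative (f \<circ> chart_inv c) (at ?y) = frechet_derivative (g \<circ> chart_inv c) (at ?y)"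
      by (rule frechet_derivative_cong[OF open_chart_image[OF c V(1)]]) (use V c q in auto)
    then show ?thesis using sm[OF f] sm[OF g] by simp
  qed
  have lin: "coord_vec A c q i (\<lambda>x. a * f x + b * g x) = a * coord_vec A c q i f + b * coord_vec A c q i g"
    if f: "smooth_near A q f" and g: "smooth_near A q g" for f g a b
  proof -
    have "((\<lambda>y. a * (f \<circ> chart_inv c) y + b * (g \<circ> chart_inv c) y) has_derivative
        (\<lambda>h. a * frechet_derivative (f \<circ> chart_inv c) (at ?y) h
          + b * frechet_derivative (g \<circ> chart_inv c) (at ?y) h)) (at ?y)"
      by (intro has_derivative_add has_derivative_mult_right D f g)
    from frechet_derivative_at[OF this]
    have "?fd (\<lambda>x. a * f x + b * g x) = a * ?fd f + b * ?fd g"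
      by (simp add: comp_def fun_eq_iff)
    moreover have "smooth_near A q (\<lambda>x. a * f x + b * g x)"
      by (intro smooth_near_add smooth_near_mult smooth_near_const f g)
    ultimately show ?thesis using sm f g by simp
  qed
  have product: "coord_vec A c q i (\<lambda>x. f x * g x) = f q * coord_vec A c q i g + g q * coord_vec A c q i f"
    if f: "smooth_near A q f" and g: "smooth_near A q g" for f g
  proof -
    have "((\<lambda>y. (f \<circ> chart_inv c) y * (g \<circ> chart_inv c) y) has_derivative
        (\<lambda>h. (f \<circ> chart_inv c) ?y * frechet_derivative (g \<circ> chart_inv c) (at ?y) h
          + frechet_derivative (f \<circ> chart_inv c) (at ?y) h * (g \<circ> chart_inv c) ?y)) (at ?y)"
      by (intro has_derivative_mult D f g)
    from frechet_derivative_at[OF this]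
    have "?fd (\<lambda>x. f x * g x) = f q * ?fd g + ?fd f * g q"
      using c q by (simp add: comp_def fun_eq_iff)
    moreover have "smooth_near A q (\<lambda>x. f x * g x)"
      by (intro smooth_near_mult f g)
    ultimately show ?thesis using sm f g by simp
  qed
  show ?thesis
    by (rule tangent_spaceI) (erule cong lin product; assumption | simp add: coord_vec_def)+
qed

text \<open>Duality of coordinates and coordinate vectors: it lets the coefficients of a combination
  of coordinate vectors be read off again.\<close>

lemma coord_vec_coord:
  assumes c: "c \<in> A" and q: "q \<in> fst c"
  shows "coord_vec A c q k (\<lambda>x. snd c x $ i) = (if i = k then 1 else 0)"
proof -
  have "frechet_derivative ((\<lambda>x. snd c x $ i) \<circ> chart_inv c) (at (snd c q))
      = frechet_derivative (\<lambda>y. y $ i) (at (snd c q))"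
    by (rule frechet_derivative_cong[OF open_chart_image[OF c open_chart_domain[OF c]]])
      (use c q in auto)
  also have "\<dots> = (\<lambda>h. h $ i)"
    using frechet_derivative_at[OF bounded_linear_imp_has_derivative[OF bounded_linear_vec_nth]] by metis
  finally show ?thesis
    using smooth_near_coord[OF c q] by (simp add: coord_vec_def axis_def)
qed

text \<open>Hadamard's lemma writes the germ of \<open>f\<close> as a constant plus products, each
  having a factor \<open>snd c x $ i - snd c q $ i\<close> that vanishes at \<open>q\<close>. A
  derivation kills the constant and, by the product rule, sees the other factor only through its
  value at \<open>q\<close>, a partial derivative of \<open>f\<close>.\<close>

lemma tangent_coord_expansion:
  assumes v: "v \<in> tangent_space A q" and c: "c \<in> A" and q: "q \<in> fst c"
  shows "v f = (\<Sum>i\<in>UNIV. v (\<lambda>x. snd c x $ i) * coord_vec A c q i f)"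
proof (cases "smooth_near A q f")
  case False
  then show ?thesis using v tangent_not_smooth by (simp add: coord_vec_def)
next
  case True
  then obtain U where U: "open U" "q \<in> U" "smooth_fun A U f"
    unfolding smooth_near_def by blast
  let ?y0 = "snd c q"
  \<comment> \<open>A ball, because Hadamard's lemma needs a convex domain.\<close>
  obtain d where d: "d > 0" "ball ?y0 d \<subseteq> snd c ` (U \<inter> fst c)"
    using open_chart_image[OF c U(1)] q U(2) open_contains_ball by (metis IntI imageI)
  let ?B = "ball ?y0 d"
  have F: "smooth_on ?B (f \<circ> chart_inv c)"
    using U(3) c d(2) unfolding smooth_fun_def by (blast intro: smooth_on_subset)
  have y0: "?y0 \<in> ?B" using d(1) by simp
  obtain G where G: "\<And>b. smooth_on ?B (G b)"
      "\<And>b. G b ?y0 = frechet_derivative (f \<circ> chart_inv c) (at ?y0) b"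
      "\<And>y. y \<in> ?B \<Longrightarrow> (f \<circ> chart_inv c) y = (f \<circ> chart_inv c) ?y0
          + (\<Sum>b\<in>Basis. ((y - ?y0) \<bullet> b) * G b y)"
    using Hadamard[OF open_ball convex_ball y0 F] by blast
  define V where "V = U \<inter> fst c \<inter> snd c -` ?B"
  have V: "open V" "q \<in> V" "V \<subseteq> fst c" "snd c ` V \<subseteq> ?B"
    using open_chart_preimage[OF c U(1) open_ball] U(2) q y0 by (auto simp: V_def)
  have G': "smooth_near A q (\<lambda>x. G b (snd c x))" for b
    by (rule smooth_nearI[OF smooth_fun_via_chart[OF c V(1,3) smooth_on_subset[OF G(1) V(4)]] V(1,2)])
  have x': "smooth_near A q (\<lambda>x. snd c x $ i - ?y0 $ i)" for i
    by (intro smooth_near_diff smooth_near_const smooth_near_coord c q)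
  have "f x = f q + (\<Sum>i\<in>UNIV. (snd c x $ i - ?y0 $ i) * G (axis i 1) (snd c x))" if "x \<in> V" for x
    using G(3)[of "snd c x"] that c q V
    by (auto simp: sum_Basis_vec inner_axis V_def)
  then have "\<forall>\<^sub>F x in nhds q. f x = f q + (\<Sum>i\<in>UNIV. (snd c x $ i - ?y0 $ i) * G (axis i 1) (snd c x))"
    using V unfolding eventually_nhds by blast
  then have "v f = v (\<lambda>x. f q + (\<Sum>i\<in>UNIV. (snd c x $ i - ?y0 $ i) * G (axis i 1) (snd c x)))"
    by (rule tangent_cong[OF v])
  also have "\<dots> = (\<Sum>i\<in>UNIV. v (\<lambda>x. (snd c x $ i - ?y0 $ i) * G (axis i 1) (snd c x)))"
    using tangent_add[OF v smooth_near_const smooth_near_sum[OF smooth_near_mult[OF x' G']]]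
    by (simp add: tangent_const[OF v] tangent_sum[OF v smooth_near_mult[OF x' G']])
  also have "\<dots> = (\<Sum>i\<in>UNIV. v (\<lambda>x. snd c x $ i) * coord_vec A c q i f)"
    unfolding tangent_product[OF v x' G']
    using True by (simp add: coord_vec_def G(2) tangent_const[OF v] mult.commute
        tangent_diff[OF v smooth_near_coord[OF c q] smooth_near_const])
  finally show ?thesis .
qed

lemma vector_field_on_subset: "vector_field_on A U X \<Longrightarrow> V \<subseteq> U \<Longrightarrow> vector_field_on A V X"
  unfolding vector_field_on_def by (meson subsetD order_trans)

lemma vector_field_tangent: "vector_field A X \<Longrightarrow> X q \<in> tangent_space A q"
  unfolding vector_field_on_def by blast

lemma vector_field_smooth:
  "vector_field A X \<Longrightarrow> open V \<Longrightarrow> smooth_fun A V f \<Longrightarrow> smooth_fun A V (\<lambda>q. X q f)"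
  unfolding vector_field_on_def by blast

lemma vector_field_smooth_near:
  "vector_field A X \<Longrightarrow> smooth_near A q f \<Longrightarrow> smooth_near A q (\<lambda>q. X q f)"
  unfolding smooth_near_def using vector_field_smooth by blast

lemma coord_vec_vector_field:
  assumes c: "c \<in> A"
  shows "vector_field_on A (fst c) (\<lambda>q. coord_vec A c q i)"
  unfolding vector_field_on_def
proof (intro conjI ballI allI impI)
  fix V f assume V: "open V" "V \<subseteq> fst c" and f: "smooth_fun A V f"
  have "coord_vec A c q i f = frechet_derivative (f \<circ> chart_inv c) (at (snd c q)) (axis i 1)"
    if "q \<in> V" for q
    using smooth_nearI[OF f V(1) that] by (simp add: coord_vec_def)
  then show "smooth_fun A V (\<lambda>q. coord_vec A c q i f)"
    using smooth_fun_partial[OF c V f] smooth_fun_cong[OF V(1)] by (metis (mono_tags, lifting))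
qed (rule coord_vec_tangent[OF c])

section \<open>Time-dependent functions\<close>

lemma smooth_time_fun_slice:
  assumes "smooth_time_fun A I U h" "open I" "open U" "t \<in> I"
  shows "smooth_fun A U (h t)"
  unfolding smooth_fun_def
proof
  fix c assume c: "c \<in> A"
  then have "smooth_on (I \<times> snd c ` (U \<inter> fst c)) (\<lambda>(t, y). h t (chart_inv c y))"
    using assms(1) by (simp add: smooth_time_fun_def)
  from smooth_on_slice[OF this assms(4,2) open_chart_image[OF c assms(3)]]
  show "smooth_on (snd c ` (U \<inter> fst c)) (h t \<circ> chart_inv c)"
    by (simp add: comp_def)
qed

text \<open>An equation for \<open>deriv\<close> alone asserts no differentiability; joint
  smoothness in a chart supplies it here.\<close>

lemma smooth_time_fun_has_derivative:
  assumes "smooth_time_fun A I U h" "open I" "open U" "t \<in> I" "q \<in> U"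
  shows "((\<lambda>s. h s q) has_real_derivative deriv (\<lambda>s. h s q) t) (at t)"
proof -
  obtain c where c: "c \<in> A" "q \<in> fst c" by (rule chart_at)
  then have "smooth_on (I \<times> snd c ` (U \<inter> fst c)) (\<lambda>(t, y). h t (chart_inv c y))"
    using assms(1) by (simp add: smooth_time_fun_def)
  then have "((\<lambda>s. h s (chart_inv c (snd c q))) has_real_derivative
      frechet_derivative (\<lambda>(t, y). h t (chart_inv c y)) (at (t, snd c q)) (1, 0)) (at t)"
    using smooth_on_partials(1)[of I "snd c ` (U \<inter> fst c)" "\<lambda>(t, y). h t (chart_inv c y)" t "snd c q"]
      c(2) assms(4,5) by simp
  then show ?thesis
    using c DERIV_imp_deriv by fastforce
qed

text \<open>The vector \<open>v\<close> does not move in time, so its components are constant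
  coefficients in the coordinate expansion. For the coordinate vectors themselves the claim is the
  interchange of a time and a space derivative.\<close>

lemma smooth_time_fun_tangent_has_derivative:
  assumes h: "smooth_time_fun A I U h" and "open I" "open U" "t \<in> I" "q \<in> U"
    and v: "v \<in> tangent_space A q"
  shows "((\<lambda>s. v (h s)) has_real_derivative v (\<lambda>x. deriv (\<lambda>s. h s x) t)) (at t)"
proof -
  obtain c where c: "c \<in> A" and q: "q \<in> fst c" by (rule chart_at)
  let ?S = "snd c ` (U \<inter> fst c)" and ?y = "snd c q"
  define F where "F = (\<lambda>(t, y). h t (chart_inv c y))"
  have S: "open ?S" by (rule open_chart_image[OF c \<open>open U\<close>])
  have F: "smooth_on (I \<times> ?S) F"
    using h c by (simp add: smooth_time_fun_def F_def)
  have y: "?y \<in> ?S" using q \<open>q \<in> U\<close> by blast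
  let ?H = "\<lambda>y. frechet_derivative F (at (t, y)) (1, 0)"
  have dt: "deriv (\<lambda>s. h s x) t = ?H (snd c x)" if "x \<in> U \<inter> fst c" for x
  proof -
    have "((\<lambda>s. F (s, snd c x)) has_real_derivative ?H (snd c x)) (at t)"
      by (rule smooth_on_partials(1)[OF F \<open>t \<in> I\<close>]) (use that in blast)
    then show ?thesis using c that by (intro DERIV_imp_deriv) (simp add: F_def)
  qed
  have "smooth_on ?S (\<lambda>y. frechet_derivative F (at (t, y)) (1, 0))"
    using smooth_on_slice[OF smooth_on_frechet_derivative[OF F] \<open>t \<in> I\<close> \<open>open I\<close> S] .
  moreover have U': "open (U \<inter> fst c)" using \<open>open U\<close> c by auto
  ultimately have "smooth_fun A (U \<inter> fst c) (\<lambda>x. ?H (snd c x))"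
    using c \<open>open U\<close> by (intro smooth_fun_via_chart) auto
  \<comment> \<open>\<open>coord_vec\<close> is \<open>0\<close> on functions not smooth near
    \<open>q\<close>, so it is known to be a partial derivative only after this smoothness is shown,
    here for the time derivative and next for each \<open>h s\<close>.\<close>
  then have dt_near: "smooth_near A q (\<lambda>x. deriv (\<lambda>s. h s x) t)"
    using smooth_fun_cong[OF U', of "\<lambda>x. ?H (snd c x)" "\<lambda>x. deriv (\<lambda>s. h s x) t"] dt U' q \<open>q \<in> U\<close>
    by (intro smooth_nearI[of "U \<inter> fst c"]) auto
  have h_near: "smooth_near A q (h s)" if "s \<in> I" for s
    using smooth_nearI smooth_time_fun_slice assms that by blast
  have "((\<lambda>s. coord_vec A c q i (h s)) has_real_derivative
      coord_vec A c q i (\<lambda>x. deriv (\<lambda>s. h s x) t)) (at t)" for i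
  proof -
    have "((\<lambda>s. frechet_derivative (\<lambda>y. F (s, y)) (at ?y) (axis i 1)) has_real_derivative
        frechet_derivative ?H (at ?y) (axis i 1)) (at t)"
      by (rule smooth_on_mixed_partials[OF F \<open>open I\<close> S \<open>t \<in> I\<close> y])
    moreover have "frechet_derivative ?H (at ?y)
        = frechet_derivative ((\<lambda>x. deriv (\<lambda>s. h s x) t) \<circ> chart_inv c) (at ?y)"
      by (rule frechet_derivative_cong[OF S y]) (use dt c in auto)
    ultimately have "((\<lambda>s. frechet_derivative (\<lambda>y. F (s, y)) (at ?y) (axis i 1)) has_real_derivative
        coord_vec A c q i (\<lambda>x. deriv (\<lambda>s. h s x) t)) (at t)"
      using dt_near by (simp add: coord_vec_def)
    then show ?thesis
      by (rule has_field_derivative_transform_within_open[OF _ \<open>open I\<close> \<open>t \<in> I\<close>])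
        (simp add: coord_vec_def h_near F_def comp_def)
  qed
  then have "((\<lambda>s. \<Sum>i\<in>UNIV. v (\<lambda>x. snd c x $ i) * coord_vec A c q i (h s)) has_real_derivative
      (\<Sum>i\<in>UNIV. v (\<lambda>x. snd c x $ i) * coord_vec A c q i (\<lambda>x. deriv (\<lambda>s. h s x) t))) (at t)"
    by (intro DERIV_sum DERIV_cmult)
  then show ?thesis
    by (simp only: tangent_coord_expansion[OF v c q, symmetric])
qed

end

section \<open>Lie brackets and the exterior derivative\<close>

context smooth_atlas
begin

lemma lie_bracket_apply:
  "smooth_near A q f \<Longrightarrow> lie_bracket A X Y q f = X q (\<lambda>x. Y x f) - Y q (\<lambda>x. X x f)"
  by (simp add: lie_bracket_def)

text \<open>An outer derivation at \<open>q\<close> will differentiate these expressions in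
  \<open>x\<close>, so the rules are required on a neighbourhood and not merely at
  \<open>q\<close>.\<close>

lemma vector_field_near:
  assumes X: "vector_field A X" and f: "smooth_near A q f" and g: "smooth_near A q g"
  shows "\<forall>\<^sub>F x in nhds q. X x (\<lambda>y. a * f y + b * g y) = a * X x f + b * X x g"
    and "\<forall>\<^sub>F x in nhds q. X x (\<lambda>y. f y * g y) = f x * X x g + g x * X x f"
proof -
  obtain U where U: "open U" "q \<in> U" "smooth_fun A U f" "smooth_fun A U g"
    using f g by (rule smooth_near_combine)
  have "X x (\<lambda>y. a * f y + b * g y) = a * X x f + b * X x g"
    and "X x (\<lambda>y. f y * g y) = f x * X x g + g x * X x f" if "x \<in> U" for x
    using U that vector_field_tangent[OF X]
    by (auto intro!: tangent_linear tangent_product smooth_nearI[of U])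
  then show "\<forall>\<^sub>F x in nhds q. X x (\<lambda>y. a * f y + b * g y) = a * X x f + b * X x g"
    and "\<forall>\<^sub>F x in nhds q. X x (\<lambda>y. f y * g y) = f x * X x g + g x * X x f"
    using U(1,2) unfolding eventually_nhds by blast+
qed

text \<open>In the second-order product rule the mixed terms
  \<open>X q g * v f + X q f * v g\<close> are symmetric in the two fields when \<open>v\<close> is
  the value of a second field. They therefore cancel in the bracket, which makes it a
  derivation.\<close>

lemma iterated_vector_fields:
  assumes X: "vector_field A X" and v: "v \<in> tangent_space A q"
  shows "smooth_near A q f \<Longrightarrow> smooth_near A q g \<Longrightarrow>
      v (\<lambda>x. X x (\<lambda>y. a * f y + b * g y)) = a * v (\<lambda>x. X x f) + b * v (\<lambda>x. X x g)"
    and "smooth_near A q f \<Longrightarrow> smooth_near A q g \<Longrightarrow>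
      v (\<lambda>x. X x (\<lambda>y. f y * g y))
        = f q * v (\<lambda>x. X x g) + X q g * v f + g q * v (\<lambda>x. X x f) + X q f * v g"
    and "\<forall>\<^sub>F x in nhds q. f x = g x \<Longrightarrow> v (\<lambda>x. X x f) = v (\<lambda>x. X x g)"
proof -
  assume f: "smooth_near A q f" and g: "smooth_near A q g"
  note Xf = vector_field_smooth_near[OF X f] and Xg = vector_field_smooth_near[OF X g]
  show "v (\<lambda>x. X x (\<lambda>y. a * f y + b * g y)) = a * v (\<lambda>x. X x f) + b * v (\<lambda>x. X x g)"
    unfolding tangent_cong[OF v vector_field_near(1)[OF X f g]] by (rule tangent_linear[OF v Xf Xg])
  show "v (\<lambda>x. X x (\<lambda>y. f y * g y))
      = f q * v (\<lambda>x. X x g) + X q g * v f + g q * v (\<lambda>x. X x f) + X q f * v g"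
    unfolding tangent_cong[OF v vector_field_near(2)[OF X f g]]
    using tangent_add[OF v smooth_near_mult[OF f Xg] smooth_near_mult[OF g Xf]]
    by (simp add: tangent_product[OF v f Xg] tangent_product[OF v g Xf])
next
  assume "\<forall>\<^sub>F x in nhds q. f x = g x"
  \<comment> \<open>Agreement near \<open>q\<close> gives agreement near every point close to
    \<open>q\<close>, so \<open>X x\<close> sees the same germ for all such
    \<open>x\<close>.\<close>
  then have "\<forall>\<^sub>F x in nhds q. \<forall>\<^sub>F y in nhds x. f y = g y"
    by (simp only: eventually_eventually)
  then have "\<forall>\<^sub>F x in nhds q. X x f = X x g"
    by (rule eventually_mono) (rule tangent_cong[OF vector_field_tangent[OF X]])
  then show "v (\<lambda>x. X x f) = v (\<lambda>x. X x g)"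
    by (rule tangent_cong[OF v])
qed

lemma vector_field_lie_bracket:
  assumes X: "vector_field A X" and Y: "vector_field A Y"
  shows "vector_field A (lie_bracket A X Y)"
  unfolding vector_field_on_def
proof (intro conjI ballI allI impI)
  fix q
  note vX = vector_field_tangent[OF X, of q] and vY = vector_field_tangent[OF Y, of q]
  show "lie_bracket A X Y q \<in> tangent_space A q"
  proof (rule tangent_spaceI)
    fix f g :: "'a \<Rightarrow> real" and a b :: real
    assume f: "smooth_near A q f" and g: "smooth_near A q g"
    have lin: "smooth_near A q (\<lambda>x. a * f x + b * g x)"
      by (intro smooth_near_add smooth_near_mult smooth_near_const f g)
    show "lie_bracket A X Y q (\<lambda>x. a * f x + b * g x)
        = a * lie_bracket A X Y q f + b * lie_bracket A X Y q g"
      unfolding lie_bracket_apply[OF f] lie_bracket_apply[OF g] lie_bracket_apply[OF lin]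
        iterated_vector_fields(1)[OF Y vX f g] iterated_vector_fields(1)[OF X vY f g]
      by (simp add: algebra_simps)
    show "lie_bracket A X Y q (\<lambda>x. f x * g x)
        = f q * lie_bracket A X Y q g + g q * lie_bracket A X Y q f"
      unfolding lie_bracket_apply[OF f] lie_bracket_apply[OF g]
        lie_bracket_apply[OF smooth_near_mult[OF f g]]
        iterated_vector_fields(2)[OF Y vX f g] iterated_vector_fields(2)[OF X vY f g]
      by (simp add: algebra_simps)
    assume "\<forall>\<^sub>F x in nhds q. f x = g x"
    then show "lie_bracket A X Y q f = lie_bracket A X Y q g"
      unfolding lie_bracket_apply[OF f] lie_bracket_apply[OF g]
      using iterated_vector_fields(3)[OF Y vX] iterated_vector_fields(3)[OF X vY] by metis
  qed (simp add: lie_bracket_def)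
next
  fix V f assume V: "open V" and f: "smooth_fun A V f"
  have "smooth_fun A V (\<lambda>q. X q (\<lambda>x. Y x f) - Y q (\<lambda>x. X x f))"
    by (rule smooth_fun_diff[OF V vector_field_smooth[OF X V vector_field_smooth[OF Y V f]]
          vector_field_smooth[OF Y V vector_field_smooth[OF X V f]]])
  moreover have "lie_bracket A X Y q f = X q (\<lambda>x. Y x f) - Y q (\<lambda>x. X x f)" if "q \<in> V" for q
    by (rule lie_bracket_apply[OF smooth_nearI[OF f V that]])
  ultimately show "smooth_fun A V (\<lambda>q. lie_bracket A X Y q f)"
    using smooth_fun_cong[OF V] by (metis (mono_tags, lifting))
qed

lemma tangent_lie_bracket:
  assumes v: "v \<in> tangent_space A q" and X: "vector_field A X" and Y: "vector_field A Y"
    and f: "smooth_near A q f"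
  shows "v (\<lambda>x. lie_bracket A X Y x f) = v (\<lambda>x. X x (\<lambda>z. Y z f)) - v (\<lambda>x. Y x (\<lambda>z. X z f))"
proof -
  obtain U where U: "open U" "q \<in> U" "smooth_fun A U f"
    using f unfolding smooth_near_def by blast
  have "lie_bracket A X Y x f = X x (\<lambda>z. Y z f) - Y x (\<lambda>z. X z f)" if "x \<in> U" for x
    by (rule lie_bracket_apply[OF smooth_nearI[OF U(3,1) that]])
  then have "\<forall>\<^sub>F x in nhds q. lie_bracket A X Y x f = X x (\<lambda>z. Y z f) - Y x (\<lambda>z. X z f)"
    using U(1,2) unfolding eventually_nhds by blast
  from tangent_cong[OF v this] show ?thesis
    using tangent_diff[OF v] vector_field_smooth_near X Y f by simp
qed

text \<open>Written as a product rule, bracketing with \<open>u\<close> being a derivation of the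
  bracket; this is the form that makes the Lie derivative commute with \<open>d\<close>. Opening all
  brackets leaves the same third-order terms on both sides, and where \<open>h\<close> is not smooth
  near \<open>q\<close> every bracket is \<open>0\<close>.\<close>

lemma Jacobi_identity:
  assumes u: "vector_field A u" and X: "vector_field A X" and Y: "vector_field A Y"
  shows "lie_bracket A u (lie_bracket A X Y) q h
    = lie_bracket A (lie_bracket A u X) Y q h + lie_bracket A X (lie_bracket A u Y) q h"
proof (cases "smooth_near A q h")
  case True
  note near = vector_field_smooth_near and tan = vector_field_tangent
  show ?thesis
    using True
    by (simp add: lie_bracket_apply near[OF X] near[OF Y] near[OF u]
        tangent_lie_bracket[OF tan[OF u] X Y] tangent_lie_bracket[OF tan[OF X] u Y]
        tangent_lie_bracket[OF tan[OF Y] u X])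
qed (simp add: lie_bracket_def)

section \<open>Lie derivative and exterior derivative of one-forms\<close>

definition lie_form1 :: "'a vfield \<Rightarrow> 'a form1 \<Rightarrow> 'a form1" where
  "lie_form1 u \<alpha> = (\<lambda>X q. u q (\<alpha> X) - \<alpha> (lie_bracket A u X) q)"

text \<open>The one-form is the differential of \<open>f\<close>; that \<open>d\<close> kills it is
  just the definition of the bracket.\<close>

lemma ext_deriv_differential:
  assumes "vector_field A X" "vector_field A Y" "smooth_near A q f"
  shows "ext_deriv A (\<lambda>Z x. Z x f) X Y q = 0"
  using assms by (simp add: ext_deriv_def lie_bracket_apply)

text \<open>The second-order terms of the two sides match because the bracket is a commutator. What
  remains is \<open>\<alpha>\<close> applied to the Jacobi identity, whose right-hand side is a sum
  of two fields; hence the additivity hypothesis.\<close>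

lemma ext_deriv_lie_form1:
  assumes u: "vector_field A u" and X: "vector_field A X" and Y: "vector_field A Y"
    and smooth: "\<And>Z. vector_field A Z \<Longrightarrow> smooth_fun A UNIV (\<alpha> Z)"
    and additive: "\<And>Z W q. vector_field A Z \<Longrightarrow> vector_field A W
      \<Longrightarrow> \<alpha> (\<lambda>x h. Z x h + W x h) q = \<alpha> Z q + \<alpha> W q"
  shows "ext_deriv A (lie_form1 u \<alpha>) X Y q = lie_form2 A u (ext_deriv A \<alpha>) X Y q"
proof -
  let ?L = "lie_bracket A"
  note br = vector_field_lie_bracket and tan = vector_field_tangent
  have sm: "smooth_near A q (\<alpha> Z)" if "vector_field A Z" for Z
    by (rule smooth_nearI[OF smooth[OF that]]) auto
  have vsm: "smooth_near A q (\<lambda>x. Z x (\<alpha> W))" if "vector_field A Z" "vector_field A W" for Z W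
    using vector_field_smooth_near[OF that(1) sm[OF that(2)]] .
  have "?L u (?L X Y) = (\<lambda>x h. ?L (?L u X) Y x h + ?L X (?L u Y) x h)"
    by (intro ext Jacobi_identity u X Y)
  then have Jacobi: "\<alpha> (?L u (?L X Y)) q = \<alpha> (?L (?L u X) Y) q + \<alpha> (?L X (?L u Y)) q"
    using additive[OF br[OF br[OF u X] Y] br[OF X br[OF u Y]], of q] by (simp only:)
  have "X q (\<lambda>x. u x (\<alpha> Y) - \<alpha> (?L u Y) x) = X q (\<lambda>x. u x (\<alpha> Y)) - X q (\<alpha> (?L u Y))"
    by (rule tangent_diff[OF tan[OF X] vsm[OF u Y] sm[OF br[OF u Y]]])
  moreover have "Y q (\<lambda>x. u x (\<alpha> X) - \<alpha> (?L u X) x) = Y q (\<lambda>x. u x (\<alpha> X)) - Y q (\<alpha> (?L u X))"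
    by (rule tangent_diff[OF tan[OF Y] vsm[OF u X] sm[OF br[OF u X]]])
  moreover have "u q (\<lambda>x. X x (\<alpha> Y) - Y x (\<alpha> X) - \<alpha> (?L X Y) x)
      = u q (\<lambda>x. X x (\<alpha> Y)) - u q (\<lambda>x. Y x (\<alpha> X)) - u q (\<alpha> (?L X Y))"
    using tangent_diff[OF tan[OF u] smooth_near_diff[OF vsm[OF X Y] vsm[OF Y X]] sm[OF br[OF X Y]]]
      tangent_diff[OF tan[OF u] vsm[OF X Y] vsm[OF Y X]] by simp
  ultimately show ?thesis
    by (simp add: ext_deriv_def lie_form1_def lie_form2_def Jacobi
        lie_bracket_apply[OF sm[OF X]] lie_bracket_apply[OF sm[OF Y]])
qed

end

section \<open>Riemannian manifolds\<close>

locale riemannian_manifold = smooth_atlas A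
  for A :: "('a::topological_space, 'm::finite) chart set" +
  fixes g :: "'a \<Rightarrow> 'a tangent \<Rightarrow> 'a tangent \<Rightarrow> real"
  assumes metric: "riemannian_metric A g"
begin

lemma metric_sym:
  "v \<in> tangent_space A q \<Longrightarrow> w \<in> tangent_space A q \<Longrightarrow> g q v w = g q w v"
  by (rule metric[unfolded riemannian_metric_def, THEN conjunct1, rule_format])

lemma metric_linear:
  "v \<in> tangent_space A q \<Longrightarrow> w \<in> tangent_space A q \<Longrightarrow> z \<in> tangent_space A q
    \<Longrightarrow> g q (\<lambda>f. a * v f + b * w f) z = a * g q v z + b * g q w z"
  by (rule metric[unfolded riemannian_metric_def, THEN conjunct2, THEN conjunct1, rule_format])

lemma metric_add_right:
  assumes "v \<in> tangent_space A q" "w \<in> tangent_space A q" "z \<in> tangent_space A q"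
  shows "g q z (\<lambda>f. v f + w f) = g q z v + g q z w"
  using metric_linear[OF assms, of 1 1] metric_sym[OF assms(1,3)] metric_sym[OF assms(2,3)]
    metric_sym[OF tangent_space_linear[OF assms(1,2), of 1 1] assms(3)] by simp

lemma metric_definite:
  "v \<in> tangent_space A q \<Longrightarrow> g q v v = 0 \<Longrightarrow> v = (\<lambda>f. 0)"
  using metric unfolding riemannian_metric_def by (metis less_irrefl)

lemma metric_smooth:
  "open U \<Longrightarrow> vector_field_on A U X \<Longrightarrow> vector_field_on A U Y \<Longrightarrow>
    smooth_fun A U (\<lambda>q. g q (X q) (Y q))"
  using metric unfolding riemannian_metric_def by blast

lemma metric_sum:
  assumes "\<And>i. i \<in> B \<Longrightarrow> v i \<in> tangent_space A q" and z: "z \<in> tangent_space A q"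
  shows "g q (\<lambda>f. \<Sum>i\<in>B. a i * v i f) z = (\<Sum>i\<in>B. a i * g q (v i) z)"
  using assms(1)
proof (induction B rule: infinite_finite_induct)
  case (insert i B)
  then show ?case
    using metric_linear[of "v i" q "\<lambda>f. \<Sum>i\<in>B. a i * v i f" z "a i" 1] tangent_space_sum[of B v q a] z
    by simp
qed (use metric_linear[OF z z z, of 0 0] in simp_all)

text \<open>Separates the components of \<open>v\<close>, which will later vary in time, from
  factors that depend only on the base point and on \<open>z\<close>.\<close>

lemma metric_coord_expansion:
  assumes v: "v \<in> tangent_space A q" and z: "z \<in> tangent_space A q"
    and c: "c \<in> A" "q \<in> fst c"
  shows "g q v z = (\<Sum>i\<in>UNIV. v (\<lambda>x. snd c x $ i) * g q (coord_vec A c q i) z)"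
proof -
  have "v = (\<lambda>f. \<Sum>i\<in>UNIV. v (\<lambda>x. snd c x $ i) * coord_vec A c q i f)"
    by (rule ext) (rule tangent_coord_expansion[OF v c])
  then have "g q v z = g q (\<lambda>f. \<Sum>i\<in>UNIV. v (\<lambda>x. snd c x $ i) * coord_vec A c q i f) z"
    by (rule arg_cong)
  also have "\<dots> = (\<Sum>i\<in>UNIV. v (\<lambda>x. snd c x $ i) * g q (coord_vec A c q i) z)"
    by (rule metric_sum[OF coord_vec_tangent[OF c] z])
  finally show ?thesis .
qed

text \<open>\<open>grad\<close> is a definite description and carries no information before this.
  Definiteness makes the Gram map injective, hence surjective in finite dimension; the gradient has
  as coordinates a preimage of the vector of values of the coordinate vectors on
  \<open>f\<close>.\<close>

lemma grad_unique_existence: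
  "\<exists>!w. w \<in> tangent_space A q \<and> (\<forall>v\<in>tangent_space A q. g q w v = v f)"
proof -
  obtain c where c: "c \<in> A" "q \<in> fst c" by (rule chart_at)
  let ?e = "coord_vec A c q"
  note e = coord_vec_tangent[OF c]
  define comb where "comb = (\<lambda>(w :: real ^ 'm) f. \<Sum>i\<in>UNIV. w $ i * ?e i f)"
  define gram where "gram = (\<lambda>w :: real ^ 'm. (\<chi> j. \<Sum>i\<in>UNIV. w $ i * g q (?e i) (?e j)))"
  have comb_tangent: "comb w \<in> tangent_space A q" for w
    unfolding comb_def by (rule tangent_space_sum[OF e])
  have g_comb: "g q (comb w) (?e j) = gram w $ j" for w j
    unfolding comb_def gram_def using metric_sum[OF e e] by simp
  have lin: "linear gram"
  proof (rule linearI)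
    fix w w' :: "real ^ 'm" and r :: real
    have "gram (w + w') $ j = gram w $ j + gram w' $ j" for j
      unfolding gram_def by (simp add: distrib_right sum.distrib)
    then show "gram (w + w') = gram w + gram w'"
      by (simp add: vec_eq_iff)
    have "gram (r *\<^sub>R w) $ j = r * gram w $ j" for j
      unfolding gram_def by (simp add: sum_distrib_left mult.assoc)
    then show "gram (r *\<^sub>R w) = r *\<^sub>R gram w"
      by (simp add: vec_eq_iff)
  qed
  have "w = 0" if "gram w = 0" for w
  proof -
    have "g q (comb w) (comb w) = (\<Sum>i\<in>UNIV. comb w (\<lambda>x. snd c x $ i) * g q (?e i) (comb w))"
      by (rule metric_coord_expansion[OF comb_tangent comb_tangent c])
    also have "\<dots> = 0"
      by (simp add: metric_sym[OF e comb_tangent] g_comb that)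
    finally have "comb w = (\<lambda>f. 0)"
      by (rule metric_definite[OF comb_tangent])
    moreover have "comb w (\<lambda>x. snd c x $ k) = w $ k" for k
      by (simp add: comb_def coord_vec_coord[OF c] if_distrib[of "\<lambda>x. _ * x"] sum.delta cong: if_cong)
    ultimately show "w = 0" by (simp add: vec_eq_iff)
  qed
  then have "surj gram"
    using lin linear_injective_0 linear_injective_imp_surjective by blast
  then obtain w where w: "gram w = (\<chi> j. ?e j f)" by (metis surjD)
  have grad: "g q (comb w) v = v f" if v: "v \<in> tangent_space A q" for v
  proof -
    have "g q (comb w) v = (\<Sum>j\<in>UNIV. v (\<lambda>x. snd c x $ j) * g q (?e j) (comb w))"
      unfolding metric_sym[OF comb_tangent v] by (rule metric_coord_expansion[OF v comb_tangent c])
    also have "\<dots> = v f"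
      by (simp add: tangent_coord_expansion[OF v c, of f] metric_sym[OF e comb_tangent] g_comb w)
    finally show ?thesis .
  qed
  show ?thesis
  proof (rule ex1I[of _ "comb w"])
    fix w' assume w': "w' \<in> tangent_space A q \<and> (\<forall>v\<in>tangent_space A q. g q w' v = v f)"
    \<comment> \<open>The coefficients \<open>1\<close> and \<open>- 1\<close> are written out to
      give the difference the shape of \<open>tangent_space_linear\<close> and
      \<open>metric_linear\<close>.\<close>
    let ?d = "\<lambda>f. 1 * w' f + (- 1) * comb w f"
    have d: "?d \<in> tangent_space A q"
      by (rule tangent_space_linear) (use w' comb_tangent in auto)
    have "g q ?d ?d = 1 * g q w' ?d + (- 1) * g q (comb w) ?d"
      by (rule metric_linear) (use w' comb_tangent d in auto)
    also have "\<dots> = 0"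
      using w' grad[OF d] d by simp
    finally have "?d = (\<lambda>f. 0)" by (rule metric_definite[OF d])
    then show "w' = comb w" by (simp add: fun_eq_iff)
  qed (use comb_tangent grad in auto)
qed

lemma grad_tangent: "grad A g f q \<in> tangent_space A q"
  and metric_grad: "v \<in> tangent_space A q \<Longrightarrow> g q (grad A g f q) v = v f"
  using theI'[OF grad_unique_existence[of q f]] unfolding grad_def by blast+

section \<open>The dual one-form and its dependence on time\<close>

lemma flat_smooth:
  "vector_field A X \<Longrightarrow> vector_field A Y \<Longrightarrow> smooth_fun A UNIV (flat g X Y)"
  unfolding flat_def by (rule metric_smooth) auto

lemma flat_add:
  "vector_field A u \<Longrightarrow> vector_field A X \<Longrightarrow> vector_field A Y
    \<Longrightarrow> flat g u (\<lambda>x h. X x h + Y x h) q = flat g u X q + flat g u Y q"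
  unfolding flat_def by (intro metric_add_right vector_field_tangent)

text \<open>The time smoothness of \<open>u\<close> is applied to the coordinate functions; the
  remaining factors are smooth in space alone and are pulled back along \<open>snd\<close>.\<close>

lemma flat_time_smooth:
  assumes u: "time_vector_field A I u" and Y: "vector_field A Y" and I: "open I"
  shows "smooth_time_fun A I UNIV (\<lambda>s. flat g (u s) Y)"
  unfolding smooth_time_fun_def
proof
  fix c assume c: "c \<in> A"
  let ?S = "snd c ` fst c"
  have S: "open ?S" using open_chart_image[OF c open_UNIV] by simp
  have IS: "open (I \<times> ?S)" using I S by (rule open_Times)
  let ?a = "\<lambda>i (t, y). u t (chart_inv c y) (\<lambda>x. snd c x $ i)"
  let ?b = "\<lambda>i y. g (chart_inv c y) (coord_vec A c (chart_inv c y) i) (Y (chart_inv c y))"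
  have "smooth_on (I \<times> ?S) (?a i)" for i
  proof -
    have "smooth_time_fun A I (fst c) (\<lambda>t q. u t q (\<lambda>x. snd c x $ i))"
      using u open_chart_domain[OF c] smooth_fun_coord[OF c] unfolding time_vector_field_def by blast
    then have "smooth_on (I \<times> snd c ` (fst c \<inter> fst c)) (?a i)"
      using c unfolding smooth_time_fun_def by blast
    then show ?thesis by simp
  qed
  moreover have "smooth_on (I \<times> ?S) (\<lambda>z. ?b i (snd z))" for i
  proof (rule smooth_on_compose[OF IS S])
    show "smooth_on (I \<times> ?S) snd"
      using smooth_on_linear[OF bounded_linear_snd IS smooth_on_ident[OF IS]] .
    have "smooth_fun A (fst c) (\<lambda>q. g q (coord_vec A c q i) (Y q))"
      using open_chart_domain[OF c] coord_vec_vector_field[OF c] vector_field_on_subset[OF Y]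
      by (intro metric_smooth) auto
    from smooth_fun_chartD[OF c _ this] show "smooth_on ?S (?b i)" by simp
  qed auto
  ultimately have sum: "smooth_on (I \<times> ?S) (\<lambda>z. \<Sum>i\<in>UNIV. ?a i z * ?b i (snd z))"
    using IS by (intro smooth_on_sum smooth_on_mult)
  have "smooth_on (I \<times> ?S) (\<lambda>z. \<Sum>i\<in>UNIV. ?a i z * ?b i (snd z))
      \<longleftrightarrow> smooth_on (I \<times> ?S) (\<lambda>(t, y). flat g (u t) Y (chart_inv c y))"
  proof (rule smooth_on_cong[OF IS])
    fix z assume "z \<in> I \<times> ?S"
    then obtain t y where z: "z = (t, y)" "t \<in> I" "y \<in> ?S" by blast
    then have "vector_field A (u t)" using u unfolding time_vector_field_def by blast
    from metric_coord_expansion[OF vector_field_tangent[OF this] vector_field_tangent[OF Y] c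
        chart_inv_mem[OF c z(3)]]
    show "(\<Sum>i\<in>UNIV. ?a i z * ?b i (snd z)) = (\<lambda>(t, y). flat g (u t) Y (chart_inv c y)) z"
      by (simp add: z flat_def)
  qed
  with sum show "smooth_on (I \<times> snd c ` (UNIV \<inter> fst c)) (\<lambda>(t, y). flat g (u t) Y (chart_inv c y))"
    by simp
qed

text \<open>Here \<open>w\<close> is the time derivative of the vector \<open>u s q\<close>, tested
  on functions. The other factors in the coordinate expansion are constant in time, so the metric
  may be applied after differentiating. That \<open>w\<close> is tangent is a hypothesis, to be
  supplied by the Euler equation.\<close>

lemma flat_time_deriv:
  assumes u: "time_vector_field A I u" and Y: "vector_field A Y" and I: "open I" "t \<in> I"
    and w: "w \<in> tangent_space A q" and dt: "\<And>f. deriv (\<lambda>s. u s q f) t = w f"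
  shows "deriv (\<lambda>s. flat g (u s) Y q) t = g q w (Y q)"
proof -
  obtain c where c: "c \<in> A" "q \<in> fst c" by (rule chart_at)
  let ?x = "\<lambda>i x. snd c x $ i"
  let ?b = "\<lambda>i. g q (coord_vec A c q i) (Y q)"
  note Yq = vector_field_tangent[OF Y, of q]
  have "((\<lambda>s. u s q (?x i)) has_real_derivative w (?x i)) (at t)" for i
  proof -
    have "smooth_time_fun A I (fst c) (\<lambda>t q. u t q (?x i))"
      using u open_chart_domain[OF c(1)] smooth_fun_coord[OF c(1)] unfolding time_vector_field_def by blast
    from smooth_time_fun_has_derivative[OF this I(1) open_chart_domain[OF c(1)] I(2) c(2)]
    show ?thesis by (simp only: dt)
  qed
  then have "((\<lambda>s. \<Sum>i\<in>UNIV. u s q (?x i) * ?b i) has_real_derivative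
      (\<Sum>i\<in>UNIV. w (?x i) * ?b i)) (at t)"
    by (intro DERIV_sum DERIV_cmult_right)
  then have "((\<lambda>s. flat g (u s) Y q) has_real_derivative (\<Sum>i\<in>UNIV. w (?x i) * ?b i)) (at t)"
  proof (rule has_field_derivative_transform_within_open[OF _ I])
    fix s assume "s \<in> I"
    then have "vector_field A (u s)" using u unfolding time_vector_field_def by blast
    from metric_coord_expansion[OF vector_field_tangent[OF this] Yq c]
    show "(\<Sum>i\<in>UNIV. u s q (?x i) * ?b i) = flat g (u s) Y q"
      by (simp add: flat_def)
  qed
  then show ?thesis
    unfolding metric_coord_expansion[OF w Yq c] by (rule DERIV_imp_deriv)
qed

text \<open>\<open>X\<close>, \<open>Y\<close> and their bracket are constant in time. In two of the
  three terms of \<open>ext_deriv\<close> the time derivative must pass a tangent vector; in the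
  third it acts pointwise.\<close>

lemma vorticity_time_derivative:
  assumes u: "time_vector_field A I u" and X: "vector_field A X" and Y: "vector_field A Y"
    and I: "open I" "t \<in> I"
  shows "((\<lambda>s. vorticity A g (u s) X Y q) has_real_derivative
    ext_deriv A (\<lambda>Z x. deriv (\<lambda>s. flat g (u s) Z x) t) X Y q) (at t)"
proof -
  note dv = smooth_time_fun_tangent_has_derivative[OF flat_time_smooth[OF u _ I(1)] I(1) open_UNIV I(2) UNIV_I]
  note ds = smooth_time_fun_has_derivative[OF flat_time_smooth[OF u _ I(1)] I(1) open_UNIV I(2) UNIV_I]
  show ?thesis
    unfolding vorticity_def ext_deriv_def
    by (rule DERIV_diff[OF DERIV_diff[OF dv[OF Y vector_field_tangent[OF X]]
          dv[OF X vector_field_tangent[OF Y]]] ds[OF vector_field_lie_bracket[OF X Y]]])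
qed

end

section \<open>Levi-Civita identities and transport of vorticity\<close>

locale levi_civita_manifold = riemannian_manifold A g
  for A :: "('a::topological_space, 'm::finite) chart set" and g +
  fixes nabla :: "'a vfield \<Rightarrow> 'a vfield \<Rightarrow> 'a vfield"
  assumes levi_civita: "levi_civita A g nabla"
begin

lemma vector_field_nabla:
  "vector_field A X \<Longrightarrow> vector_field A Y \<Longrightarrow> vector_field A (nabla X Y)"
  using levi_civita unfolding levi_civita_def by blast

lemma torsion_free:
  assumes "vector_field A X" "vector_field A Y"
  shows "nabla X Y q h = nabla Y X q h + lie_bracket A X Y q h"
  using levi_civita[unfolded levi_civita_def, THEN conjunct1, rule_format, OF assms]
  by (metis diff_add_cancel add.commute)

lemma metric_compatible:
  "vector_field A X \<Longrightarrow> vector_field A Y \<Longrightarrow> vector_field A Z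
    \<Longrightarrow> X q (\<lambda>x. g x (Y x) (Z x)) = g q (nabla X Y q) (Z q) + g q (Y q) (nabla X Z q)"
  using levi_civita unfolding levi_civita_def by blast

text \<open>Metric compatibility turns \<open>u\<close> applied to \<open>g(u, Z)\<close> into the
  left-hand side plus \<open>g(u, nabla u Z)\<close>. Absence of torsion replaces
  \<open>nabla u Z\<close> by \<open>nabla Z u\<close> plus a bracket, which completes
  \<open>lie_form1\<close>. The remaining \<open>g(u, nabla Z u)\<close> is half of \<open>Z\<close>
  applied to \<open>g(u, u)\<close>.\<close>

lemma metric_nabla_self:
  assumes u: "vector_field A u" and Z: "vector_field A Z"
  shows "g q (nabla u u q) (Z q) = lie_form1 u (flat g u) Z q - Z q (\<lambda>x. g x (u x) (u x)) / 2"
proof -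
  note tan = vector_field_tangent
  have "g q (u q) (nabla u Z q) = g q (u q) (nabla Z u q) + g q (u q) (lie_bracket A u Z q)"
    using metric_add_right[OF tan[OF vector_field_nabla[OF Z u]] tan[OF vector_field_lie_bracket[OF u Z]]
        tan[OF u], of q] torsion_free[OF u Z, of q] by (metis (no_types, lifting) ext)
  moreover have "g q (nabla Z u q) (u q) = g q (u q) (nabla Z u q)"
    by (intro metric_sym tan vector_field_nabla u Z)
  ultimately show ?thesis
    using metric_compatible[OF u u Z, of q] metric_compatible[OF Z u u, of q]
    by (simp add: lie_form1_def flat_def)
qed

lemma euler_flat:
  assumes u: "time_vector_field A I u" and I: "open I" "t \<in> I" and Z: "vector_field A Z"
    and p: "smooth_fun A UNIV p"
    and euler: "\<And>q f. deriv (\<lambda>s. u s q f) t + nabla (u t) (u t) q f = - grad A g p q f"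
  shows "deriv (\<lambda>s. flat g (u s) Z q) t
    = - lie_form1 (u t) (flat g (u t)) Z q + Z q (\<lambda>x. (1 / 2) * g x (u t x) (u t x) - p x)"
proof -
  have ut: "vector_field A (u t)" using u I unfolding time_vector_field_def by blast
  note nab = vector_field_tangent[OF vector_field_nabla[OF ut ut], of q]
  note Zq = vector_field_tangent[OF Z, of q]
  \<comment> \<open>The Euler equation solved for the time derivative of \<open>u\<close>; a
    combination of two tangent vectors, it is tangent as \<open>flat_time_deriv\<close>
    requires.\<close>
  let ?w = "\<lambda>f. (- 1) * nabla (u t) (u t) q f + (- 1) * grad A g p q f"
  have "deriv (\<lambda>s. u s q f) t = ?w f" for f
    using euler[of q f] by simp
  then have "deriv (\<lambda>s. flat g (u s) Z q) t = g q ?w (Z q)"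
    by (intro flat_time_deriv[OF u Z I] tangent_space_linear nab grad_tangent)
  also have "\<dots> = - g q (nabla (u t) (u t) q) (Z q) - Z q p"
    unfolding metric_linear[OF nab grad_tangent Zq] by (simp add: metric_grad[OF Zq])
  finally have dt: "deriv (\<lambda>s. flat g (u s) Z q) t = - g q (nabla (u t) (u t) q) (Z q) - Z q p" .
  have dphi: "Z q (\<lambda>x. (1 / 2) * g x (u t x) (u t x) - p x) = Z q (\<lambda>x. g x (u t x) (u t x)) / 2 - Z q p"
  proof -
    have "smooth_near A q p" "smooth_near A q (\<lambda>x. g x (u t x) (u t x))"
      using p flat_smooth[OF ut ut] by (auto intro: smooth_nearI simp: flat_def)
    then show ?thesis
      using tangent_linear[OF Zq, of "\<lambda>x. g x (u t x) (u t x)" p "1 / 2" "- 1"] by simp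
  qed
  with dt show ?thesis by (simp add: metric_nabla_self[OF ut Z])
qed

theorem vorticity_transport:
  assumes u: "time_vector_field A I u" and I: "open I" "t \<in> I"
    and X: "vector_field A X" and Y: "vector_field A Y" and p: "smooth_fun A UNIV p"
    and euler: "\<And>q f. deriv (\<lambda>s. u s q f) t + nabla (u t) (u t) q f = - grad A g p q f"
  shows "((\<lambda>s. vorticity A g (u s) X Y q) has_real_derivative
    - lie_form2 A (u t) (vorticity A g (u t)) X Y q) (at t)"
proof -
  have ut: "vector_field A (u t)" using u I unfolding time_vector_field_def by blast
  define \<phi> where "\<phi> = (\<lambda>x. (1 / 2) * g x (u t x) (u t x) - p x)"
  define \<beta> where "\<beta> = lie_form1 (u t) (flat g (u t))"
  let ?dt = "\<lambda>Z x. deriv (\<lambda>s. flat g (u s) Z x) t"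
  note tan = vector_field_tangent and br = vector_field_lie_bracket[OF X Y]
  \<comment> \<open>Wanted for every field \<open>Z\<close>, since \<open>ext_deriv\<close>
    evaluates the form on the bracket besides \<open>X\<close> and \<open>Y\<close>. The factors
    \<open>- 1\<close> and \<open>1\<close> fit \<open>tangent_linear\<close>.\<close>
  have dt: "?dt Z = (\<lambda>x. (- 1) * \<beta> Z x + 1 * Z x \<phi>)" if "vector_field A Z" for Z
    using euler_flat[OF u I that p euler] by (simp add: \<beta>_def \<phi>_def fun_eq_iff)
  \<comment> \<open>Derivations are linear on functions smooth near \<open>q\<close>, so both parts
    of the right-hand side must be shown smooth before they are split.\<close>
  have \<phi>: "smooth_near A q \<phi>"
    unfolding \<phi>_def using p flat_smooth[OF ut ut]
    by (intro smooth_near_diff smooth_near_mult smooth_near_const) (auto intro: smooth_nearI simp: flat_def)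
  have \<beta>: "smooth_near A q (\<beta> Z)" if "vector_field A Z" for Z
    unfolding \<beta>_def lie_form1_def
    using that flat_smooth[OF ut] vector_field_lie_bracket[OF ut that] smooth_nearI[of UNIV _ q]
    by (intro smooth_near_diff vector_field_smooth_near[OF ut]) auto
  have lin: "W q (\<lambda>x. (- 1) * \<beta> Z x + 1 * Z x \<phi>) = (- 1) * W q (\<beta> Z) + 1 * W q (\<lambda>x. Z x \<phi>)"
    if "vector_field A W" "vector_field A Z" for W Z
    by (rule tangent_linear[OF tan[OF that(1)] \<beta>[OF that(2)] vector_field_smooth_near[OF that(2) \<phi>]])
  have "ext_deriv A ?dt X Y q = - ext_deriv A \<beta> X Y q + ext_deriv A (\<lambda>Z x. Z x \<phi>) X Y q"
    using lin[OF X Y] lin[OF Y X] fun_cong[OF dt[OF br], of q]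
    unfolding ext_deriv_def dt[OF X] dt[OF Y] by simp
  also have "\<dots> = - lie_form2 A (u t) (vorticity A g (u t)) X Y q"
    unfolding \<beta>_def vorticity_def ext_deriv_differential[OF X Y \<phi>]
    by (simp add: ext_deriv_lie_form1[OF ut X Y flat_smooth[OF ut] flat_add[OF ut]])
  finally show ?thesis
    using vorticity_time_derivative[OF u X Y I, of q] by simp
qed

end

section \<open>Application to each phase of the fluid\<close>

theorem corollary1p10:
  fixes A :: "('a::t2_space, 'm::finite) chart set"
    and g :: "'a \<Rightarrow> 'a tangent \<Rightarrow> 'a tangent \<Rightarrow> real"
    and nabla :: "'a vfield \<Rightarrow> 'a vfield \<Rightarrow> 'a vfield"
    and n :: nat
    and c :: "nat \<Rightarrow> real"
    and I :: "real set"
    and u :: "nat \<Rightarrow> real \<Rightarrow> 'a vfield"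
    and \<mu> :: "nat \<Rightarrow> real \<Rightarrow> ('a, 'm) topform"
    and p :: "real \<Rightarrow> 'a \<Rightarrow> real"
  assumes "compact (UNIV :: 'a set)" and "connected (UNIV :: 'a set)"
    and "oriented_atlas A"
    and "riemannian_metric A g"
    and "levi_civita A g nabla"
    and "(\<Sum>j=1..n. c j) = topform_integral A (vol_form A g)"
    and "open I" and "is_interval I"
    and u_smooth: "\<And>j. j \<in> {1..n} \<Longrightarrow> time_vector_field A I (u j)"
    and mu_smooth: "\<And>j. j \<in> {1..n} \<Longrightarrow> time_topform A I (\<mu> j)"
    and p_smooth: "\<And>t. t \<in> I \<Longrightarrow> smooth_fun A UNIV (p t)"
    and mu_MDens: "\<And>t. t \<in> I \<Longrightarrow> (\<lambda>j. \<mu> j t) \<in> MDens A g n c"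
    and constraint: "\<And>t X q. t \<in> I \<Longrightarrow> (\<And>i. vector_field A (X i)) \<Longrightarrow>
          (\<Sum>j=1..n. lie_topform A (u j t) (\<mu> j t) X q) = 0"
    and euler: "\<And>j t q f. j \<in> {1..n} \<Longrightarrow> t \<in> I \<Longrightarrow>
          deriv (\<lambda>s. u j s q f) t + nabla (u j t) (u j t) q f = - grad A g (p t) q f"
    and continuity: "\<And>j t X q. j \<in> {1..n} \<Longrightarrow> t \<in> I \<Longrightarrow> (\<And>i. vector_field A (X i)) \<Longrightarrow>
          deriv (\<lambda>s. \<mu> j s X q) t = - lie_topform A (u j t) (\<mu> j t) X q"
  shows "\<forall>j\<in>{1..n}. \<forall>t\<in>I. \<forall>X Y q. vector_field A X \<longrightarrow> vector_field A Y \<longrightarrow>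
           (\<lambda>s. vorticity A g (u j s) X Y q) differentiable (at t) \<and>
           deriv (\<lambda>s. vorticity A g (u j s) X Y q) t
             + lie_form2 A (u j t) (vorticity A g (u j t)) X Y q = 0"
proof (intro ballI allI impI)
  fix j t X Y q
  assume j: "j \<in> {1..n}" and t: "t \<in> I" and X: "vector_field A X" and Y: "vector_field A Y"
  interpret levi_civita_manifold A g nabla
    by unfold_locales fact+
  have "((\<lambda>s. vorticity A g (u j s) X Y q) has_real_derivative
      - lie_form2 A (u j t) (vorticity A g (u j t)) X Y q) (at t)"
    by (rule vorticity_transport[OF u_smooth[OF j] \<open>open I\<close> t X Y p_smooth[OF t] euler[OF j t]])
  then show "(\<lambda>s. vorticity A g (u j s) X Y q) differentiable (at t) \<and>
      deriv (\<lambda>s. vorticity A g (u j s) X Y q) t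
        + lie_form2 A (u j t) (vorticity A g (u j t)) X Y q = 0"
    by (auto simp: DERIV_imp_deriv real_differentiable_def)
qed

end
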